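(* Let $G$ be a non-compact second countable locally compact group, let $1\le p<\infty$, let $S\subset G$ be any subset, and let $\omega$ be an $S$-admissible weight on $G$. There is an $S$-dense vector in $L^p(G,\omega)$ if and only if the following holds: for every increasing sequence $(F_n)_{n\ge 1}$ of compact subsets of $G$ and any given sequence of numbers $\delta_n>0$ ($n\ge1$), there exist a sequence $(s_n)_{n\ge1}\subset S$ and compact sets $K_n\subset F_n$ ($n\ge 1$) such that the sets $s_n^{-1}F_n$ ($n\ge1$) are pairwise disjoint, $|F_n\setminus K_n|<\delta_n$ for all $n\ge 1$ and, setting $s_0=e$, $K_0=\emptyset$, $$\sum_{n,k\ge 0:\ n\ne k}\ \int_{s_ns_k^{-1}K_k}\omega^p\,d\mu<\infty .$$
   Context: $G$ has identity $e$ and left Haar measure $\mu$; $|A|=\mu(A)$. A weight on $G$ is a measurable strictly positive function $\omega$ which is locally $p$-summable, i.e. $\int_K\omega^p\,d\mu<\infty$ for every compact $K\subset G$. $L^p(G,\omega)$ is the space of (classes of) complex-valued measurable functions $f$ on $G$ with $\|f\|_{p,\omega}=\big(\int_G|f\omega|^p\,d\mu\big)^{1/p}<\infty$. For $s\in G$, $(T_sf)(t)=f(s^{-1}t)$. A weight $\omega$ is $S$-admissible if for each $s\in S$ the operator $T_s$ is bounded on $L^p(G,\omega)$; equivalently $\|T_s\|=\operatorname{ess\,sup}_{t\in G}\omega(st)/\omega(t)<\infty$ for all $s\in S$. A vector $f\in L^p(G,\omega)$ is $S$-dense if $\{T_sf:s\in S\}$ is dense in $L^p(G,\omega)$. "Increasing"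 means $F_n\subset F_{n+1}$. *)

theory Defs
  imports "HOL-Analysis.Analysis"
begin

text \<open>
  Groups are written additively, but \<^class>\<open>group_add\<close> does not assume commutativity:
  \<open>s + t\<close> stands for the product \<open>s t\<close>, \<open>- s\<close> for \<open>s\<inverse>\<close> and \<open>0\<close> for the identity.
\<close>

text \<open>A left Haar measure: a nonzero left-invariant Radon measure, given on the Borel sets.\<close>

definition left_haar_measure ::
    "'g :: {topological_group_add, t2_space} measure \<Rightarrow> bool" where
  "left_haar_measure \<mu> \<longleftrightarrow>
     sets \<mu> = sets borel \<and>
     emeasure \<mu> UNIV \<noteq> 0 \<and>
     (\<forall>s. \<forall>A\<in>sets borel. emeasure \<mu> ((\<lambda>x. s + x) ` A) = emeasure \<mu> A) \<and>
     (\<forall>K. compact K \<longrightarrow> emeasure \<mu> K < \<infinity>) \<and>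
     (\<forall>A\<in>sets borel. emeasure \<mu> A = (INF U\<in>{U. open U \<and> A \<subseteq> U}. emeasure \<mu> U)) \<and>
     (\<forall>U. open U \<longrightarrow> emeasure \<mu> U = (SUP K\<in>{K. compact K \<and> K \<subseteq> U}. emeasure \<mu> K))"

text \<open>
  The definitions below take an arbitrary measure \<open>M\<close>. Instantiating \<open>M\<close> with the completion of a
  Haar measure makes ``measurable'' mean Haar measurable (not just Borel measurable).
\<close>

definition weight ::
    "'g :: topological_space measure \<Rightarrow> real \<Rightarrow> ('g \<Rightarrow> real) \<Rightarrow> bool" where
  "weight M p \<omega> \<longleftrightarrow>
     \<omega> \<in> borel_measurable M \<and> (\<forall>t. 0 < \<omega> t) \<and>
     (\<forall>K. compact K \<longrightarrow> (\<integral>\<^sup>+t\<in>K. ennreal (\<omega> t powr p) \<partial>M) < \<infinity>)"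

text \<open>
  The weighted \<open>L\<^sup>p\<close> space is represented by functions rather than by classes modulo almost everywhere
  equality; accordingly \<open>Lp_norm\<close> is a seminorm. It is meaningful only on \<open>Lp_space\<close>
  (the Bochner integral of a non-integrable function is 0).
\<close>

definition Lp_space :: "'g measure \<Rightarrow> real \<Rightarrow> ('g \<Rightarrow> real) \<Rightarrow> ('g \<Rightarrow> complex) set" where
  "Lp_space M p \<omega> =
     {f \<in> borel_measurable M. integrable M (\<lambda>t. (norm (f t) * \<omega> t) powr p)}"

definition Lp_norm :: "'g measure \<Rightarrow> real \<Rightarrow> ('g \<Rightarrow> real) \<Rightarrow> ('g \<Rightarrow> complex) \<Rightarrow> real" where
  "Lp_norm M p \<omega> f = (\<integral>t. (norm (f t) * \<omega> t) powr p \<partial>M) powr (1 / p)"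

definition translate :: "'g :: group_add \<Rightarrow> ('g \<Rightarrow> complex) \<Rightarrow> 'g \<Rightarrow> complex" where
  "translate s f = (\<lambda>t. f (- s + t))"

definition admissible ::
    "'g :: group_add measure \<Rightarrow> real \<Rightarrow> 'g set \<Rightarrow> ('g \<Rightarrow> real) \<Rightarrow> bool" where
  "admissible M p S \<omega> \<longleftrightarrow>
     (\<forall>s\<in>S. \<exists>C. \<forall>f\<in>Lp_space M p \<omega>.
        translate s f \<in> Lp_space M p \<omega> \<and>
        Lp_norm M p \<omega> (translate s f) \<le> C * Lp_norm M p \<omega> f)"

definition dense_vector ::
    "'g :: group_add measure \<Rightarrow> real \<Rightarrow> 'g set \<Rightarrow> ('g \<Rightarrow> real) \<Rightarrow> ('g \<Rightarrow> complex) \<Rightarrow> bool" where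
  "dense_vector M p S \<omega> f \<longleftrightarrow>
     f \<in> Lp_space M p \<omega> \<and>
     (\<forall>s\<in>S. translate s f \<in> Lp_space M p \<omega>) \<and>
     (\<forall>g\<in>Lp_space M p \<omega>. \<forall>\<epsilon>>0. \<exists>s\<in>S. Lp_norm M p \<omega> (\<lambda>t. translate s f t - g t) < \<epsilon>)"

end

theory Submission
  imports Defs
begin

text \<open>
  Write \<open>\<nu>\<close> for the measure with density \<open>\<omega>\<^sup>p\<close>, so that the \<open>p\<close>-th power of the norm of \<open>h\<close> is the
  integral of \<open>|h|\<^sup>p\<close> with respect to \<open>\<nu>\<close> (the modular of \<open>h\<close>), and the double sum of the theorem is
  the sum of the numbers \<open>\<nu> (s n - s k + K k)\<close>. Both directions compare such sums with modulars of
  functions that live on disjoint translates.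

  Necessity (\<open>necessity\<close>). Let \<open>f\<close> be a dense vector. Choose \<open>s n\<close> such that the translate of \<open>f\<close> by
  \<open>s n\<close> is close to a large multiple of the indicator of \<open>F n\<close>, and let \<open>K n\<close> be a compact part of
  \<open>F n\<close> on which the translate has modulus at least 1; since \<open>\<mu>\<close> is absolutely continuous with
  respect to \<open>\<nu>\<close>, only a small part of \<open>F n\<close> is lost. If the sets \<open>- s n + F n\<close> are disjoint, then for
  \<open>k \<noteq> n\<close> the set \<open>s n - s k + K k\<close> is disjoint from \<open>F n\<close> and the translate has modulus at least 1 on it
  as well. So the \<open>n\<close>-th row of the double sum is at most the modular of the approximation error, which
  can be taken below \<open>2\<^sup>-\<^sup>n\<close>; row 0 is at most the modular of \<open>f\<close>. Disjointness means that \<open>s n\<close> has to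
  avoid a compact set determined by the earlier choices. This is where the large multiple is used:
  translations by elements of a compact set move only a bounded region of the group into \<open>F n\<close>, and \<open>f\<close>
  is not large on most of that region
  (\<open>dense_vector_approximates_outside_compact\<close>, \<open>disjoint_translates_choice\<close>).

  Sufficiency (\<open>sufficiency\<close>). List a countable dense family of bounded compactly supported functions
  (\<open>countable_dense_compact_support\<close>) as a sequence \<open>g j\<close> in which each member recurs infinitely often,
  and apply the hypothesis to an increasing sequence of compact sets with \<open>g j\<close> supported in \<open>F j\<close>.
  Finiteness of the double sum forces the column sums to tend to 0. Hence a subsequence can be chosen
  along which the columns stay summable after multiplication by \<open>(sup |g j|)\<^sup>p\<close>; passing to larger indices
  keeps \<open>g j\<close> supported in the corresponding compact set because the sequence increases. Moving each \<open>g j\<close>, cut down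
  to \<open>K j\<close>, back by its own group element and adding up gives \<open>f\<close> (\<open>glue\<close>). Translating \<open>f\<close> by the
  \<open>i\<close>-th element restores the truncated \<open>g i\<close> up to an error bounded by the \<open>i\<close>-th weighted row
  (\<open>Lp_modular_translate_glue_diff\<close>), and rows of a finite double sum tend to 0 too.
\<close>

section \<open>The modular of a weighted Lebesgue space\<close>

text \<open>
  The \<open>p\<close>-th power of the \<open>L\<^sup>p\<close> norm, with values in \<open>[0, \<infinity>]\<close>. Sums of integrals over disjoint sets are
  additive for it, and the crude inequality \<open>Lp_modular_add_le\<close> serves instead of the triangle inequality.
\<close>

definition Lp_modular :: "'a measure \<Rightarrow> real \<Rightarrow> ('a \<Rightarrow> complex) \<Rightarrow> ennreal" where
  "Lp_modular N p h = (\<integral>\<^sup>+t. ennreal (norm (h t) powr p) \<partial>N)"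

lemma norm_add_powr_le:
  fixes a b :: "'a::real_normed_vector"
  assumes "0 \<le> p"
  shows "norm (a + b) powr p \<le> 2 powr p * (norm a powr p + norm b powr p)"
proof -
  have "norm (a + b) powr p \<le> (2 * max (norm a) (norm b)) powr p"
    using norm_triangle_ineq[of a b] assms by (intro powr_mono2) auto
  also have "\<dots> = 2 powr p * max (norm a) (norm b) powr p"
    by (simp add: powr_mult)
  also have "\<dots> \<le> 2 powr p * (norm a powr p + norm b powr p)"
    by (intro mult_left_mono) (auto simp: max_def)
  finally show ?thesis .
qed

lemma Lp_modular_add_le:
  assumes [measurable]: "f \<in> borel_measurable N" "g \<in> borel_measurable N" and "0 \<le> p"
  shows "Lp_modular N p (\<lambda>t. f t + g t) \<le> ennreal (2 powr p) * (Lp_modular N p f + Lp_modular N p g)"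
proof -
  have "Lp_modular N p (\<lambda>t. f t + g t)
      \<le> (\<integral>\<^sup>+t. ennreal (2 powr p) * (ennreal (norm (f t) powr p) + ennreal (norm (g t) powr p)) \<partial>N)"
    unfolding Lp_modular_def using norm_add_powr_le[OF \<open>0 \<le> p\<close>]
    by (intro nn_integral_mono) (simp flip: ennreal_plus ennreal_mult)
  also have "\<dots> = ennreal (2 powr p) * (Lp_modular N p f + Lp_modular N p g)"
    unfolding Lp_modular_def by (simp add: nn_integral_cmult nn_integral_add)
  finally show ?thesis .
qed

lemma ennreal_mult_add_less:
  fixes x y :: ennreal
  assumes "0 < c" "x < ennreal (\<epsilon> / (2 * c))" "y < ennreal (\<epsilon> / (2 * c))"
  shows "ennreal c * (x + y) < ennreal \<epsilon>"
proof -
  obtain a where a: "x = ennreal a" "0 \<le> a" using assms by (cases x) auto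
  obtain b where b: "y = ennreal b" "0 \<le> b" using assms by (cases y) auto
  have "a < \<epsilon> / (2 * c)" "b < \<epsilon> / (2 * c)"
    using assms a b by (auto simp: ennreal_less_iff)
  then have "c * (a + b) < \<epsilon>" using \<open>0 < c\<close> by (simp add: field_simps)
  then show ?thesis using a b \<open>0 < c\<close>
    by (simp add: ennreal_less_iff flip: ennreal_plus ennreal_mult)
qed

text \<open>The form in which the quasi-triangle inequality enters \<open>\<epsilon>\<close>-arguments.\<close>

lemma Lp_modular_add_less:
  assumes "f \<in> borel_measurable N" "g \<in> borel_measurable N" "0 \<le> p"
    and "Lp_modular N p f < ennreal (\<epsilon> / (2 * 2 powr p))"
    and "Lp_modular N p g < ennreal (\<epsilon> / (2 * 2 powr p))"
  shows "Lp_modular N p (\<lambda>t. f t + g t) < ennreal \<epsilon>"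
  using Lp_modular_add_le[OF assms(1-3)] ennreal_mult_add_less[OF _ assms(4,5)]
  by (auto intro: le_less_trans)

lemma Lp_modular_mult_indicator:
  assumes "A \<in> sets N" "0 < p"
  shows "Lp_modular N p (\<lambda>t. c * indicator A t) = ennreal (norm c powr p) * emeasure N A"
proof -
  have "ennreal (norm (c * indicator A t :: complex) powr p) = ennreal (norm c powr p) * indicator A t" for t
    using assms by (auto simp: indicator_def)
  then show ?thesis using assms by (simp add: Lp_modular_def nn_integral_cmult_indicator)
qed

lemma Lp_modular_mono:
  assumes "\<And>t. norm (f t) \<le> norm (g t)" "0 \<le> p"
  shows "Lp_modular N p f \<le> Lp_modular N p g"
  unfolding Lp_modular_def using assms by (intro nn_integral_mono ennreal_leI powr_mono2) auto

lemma Lp_modular_cong_AE: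
  assumes "AE t in N. f t = g t"
  shows "Lp_modular N p f = Lp_modular N p g"
  unfolding Lp_modular_def using assms by (intro nn_integral_cong_AE) auto

section \<open>Approximation by a countable family\<close>

definition Lp_closure :: "'a measure \<Rightarrow> real \<Rightarrow> ('a \<Rightarrow> complex) set \<Rightarrow> ('a \<Rightarrow> complex) set" where
  "Lp_closure N p D = {f \<in> borel_measurable N. \<forall>\<epsilon>>0. \<exists>d\<in>D. Lp_modular N p (\<lambda>t. f t - d t) < ennreal \<epsilon>}"

lemma Lp_closure_add:
  assumes D: "D \<subseteq> borel_measurable N" "\<And>d e. d \<in> D \<Longrightarrow> e \<in> D \<Longrightarrow> (\<lambda>t. d t + e t) \<in> D"
    and "0 \<le> p" and f: "f \<in> Lp_closure N p D" and g: "g \<in> Lp_closure N p D"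
  shows "(\<lambda>t. f t + g t) \<in> Lp_closure N p D"
  unfolding Lp_closure_def
proof (safe)
  have m: "f \<in> borel_measurable N" "g \<in> borel_measurable N"
    using f g by (auto simp: Lp_closure_def)
  show "(\<lambda>t. f t + g t) \<in> borel_measurable N" using m by measurable
  fix \<epsilon> :: real assume "0 < \<epsilon>"
  then have pos: "0 < \<epsilon> / (2 * 2 powr p)" by simp
  obtain d where d: "d \<in> D" "Lp_modular N p (\<lambda>t. f t - d t) < ennreal (\<epsilon> / (2 * 2 powr p))"
    using f pos by (auto simp: Lp_closure_def)
  obtain e where e: "e \<in> D" "Lp_modular N p (\<lambda>t. g t - e t) < ennreal (\<epsilon> / (2 * 2 powr p))"
    using g pos by (auto simp: Lp_closure_def)
  have m': "d \<in> borel_measurable N" "e \<in> borel_measurable N" using D(1) d e by auto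
  have "Lp_modular N p (\<lambda>t. (f t - d t) + (g t - e t)) < ennreal \<epsilon>"
    using m m' \<open>0 \<le> p\<close> d e by (intro Lp_modular_add_less borel_measurable_diff)
  then show "\<exists>h\<in>D. Lp_modular N p (\<lambda>t. f t + g t - h t) < ennreal \<epsilon>"
    using D(2)[OF d(1) e(1)] by (intro bexI[of _ "\<lambda>t. d t + e t"]) (auto simp: algebra_simps)
qed

lemma Lp_closure_limit:
  assumes D: "D \<subseteq> borel_measurable N" and "0 \<le> p"
    and f: "f \<in> borel_measurable N" "\<And>n. g n \<in> Lp_closure N p D"
    and lim: "(\<lambda>n::nat. Lp_modular N p (\<lambda>t. f t - g n t)) \<longlonglongrightarrow> 0"
  shows "f \<in> Lp_closure N p D"
  unfolding Lp_closure_def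
proof (safe)
  show "f \<in> borel_measurable N" by fact
  fix \<epsilon> :: real assume "0 < \<epsilon>"
  then have pos: "0 < \<epsilon> / (2 * 2 powr p)" by simp
  then have "\<forall>\<^sub>F n in sequentially. Lp_modular N p (\<lambda>t. f t - g n t) < ennreal (\<epsilon> / (2 * 2 powr p))"
    using lim by (intro order_tendstoD(2)) (auto simp: ennreal_zero_less_divide)
  then obtain n where n: "Lp_modular N p (\<lambda>t. f t - g n t) < ennreal (\<epsilon> / (2 * 2 powr p))"
    by (auto simp: eventually_sequentially)
  obtain d where d: "d \<in> D" "Lp_modular N p (\<lambda>t. g n t - d t) < ennreal (\<epsilon> / (2 * 2 powr p))"
    using f(2)[of n] pos by (auto simp: Lp_closure_def)
  have m: "g n \<in> borel_measurable N" "d \<in> borel_measurable N"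
    using f(2)[of n] D d by (auto simp: Lp_closure_def)
  have "Lp_modular N p (\<lambda>t. (f t - g n t) + (g n t - d t)) < ennreal \<epsilon>"
    using m f \<open>0 \<le> p\<close> d n by (intro Lp_modular_add_less borel_measurable_diff)
  then show "\<exists>d\<in>D. Lp_modular N p (\<lambda>t. f t - d t) < ennreal \<epsilon>"
    using d by (intro bexI[of _ d]) auto
qed

lemma countable_compact_cover:
  assumes "locally compact (UNIV :: 'g::second_countable_topology set)"
  obtains L :: "nat \<Rightarrow> 'g::second_countable_topology set" where "\<And>n. compact (L n)" "incseq L" "(\<Union>n. L n) = UNIV"
proof -
  define \<U> where "\<U> = {U :: 'g set. open U \<and> (\<exists>C. compact C \<and> U \<subseteq> C)}"
  have "x \<in> \<Union>\<U>" for x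
  proof -
    obtain U C where "open U" "compact C" "x \<in> U" "U \<subseteq> C"
      using assms unfolding locally_def by (metis UNIV_I openin_subtopology_self subtopology_UNIV open_openin topspace_euclidean openin_topspace)
    then show ?thesis by (auto simp: \<U>_def)
  qed
  moreover obtain \<V> where \<V>: "\<V> \<subseteq> \<U>" "countable \<V>" "\<Union>\<V> = \<Union>\<U>"
    by (rule Lindelof[of \<U>]) (auto simp: \<U>_def)
  ultimately have U: "\<Union>\<V> = UNIV" by auto
  then have "\<V> \<noteq> {}" by auto
  define V where "V = from_nat_into \<V>"
  have V: "range V = \<V>" using \<open>\<V> \<noteq> {}\<close> \<V>(2) by (simp add: V_def range_from_nat_into)
  have "\<exists>C. compact C \<and> V n \<subseteq> C" for n using V \<V>(1) by (auto simp: \<U>_def)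
  then obtain C where C: "\<And>n. compact (C n)" "\<And>n. V n \<subseteq> C n" by metis
  show ?thesis
  proof (rule that[of "\<lambda>n. \<Union>k\<le>n. C k"])
    show "compact (\<Union>k\<le>n. C k)" for n using C by (intro compact_UN) auto
    show "incseq (\<lambda>n. \<Union>k\<le>n. C k)" by (intro incseq_SucI) (auto simp: le_Suc_eq)
    have "UNIV \<subseteq> (\<Union>n. V n)" using U V by auto
    then show "(\<Union>n. \<Union>k\<le>n. C k) = UNIV" using C(2) by (auto) blast
  qed
qed

lemma Lp_closure_cong_AE:
  assumes D: "D \<subseteq> borel_measurable N" and "0 < p"
    and f: "f \<in> Lp_closure N p D" and g: "g \<in> borel_measurable N" and eq: "AE t in N. f t = g t"
  shows "g \<in> Lp_closure N p D"
proof (rule Lp_closure_limit[OF D _ g, of _ "\<lambda>_. f"])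
  have "Lp_modular N p (\<lambda>t. g t - f t) = Lp_modular N p (\<lambda>t. 0)"
    using eq by (intro Lp_modular_cong_AE) auto
  then show "(\<lambda>n. Lp_modular N p (\<lambda>t. g t - f t)) \<longlonglongrightarrow> 0"
    using \<open>0 < p\<close> by (simp add: Lp_modular_def)
  show "0 \<le> p" using \<open>0 < p\<close> by simp
  show "f \<in> Lp_closure N p D" by fact
qed

text \<open>
  Continuity of the measure from above makes the closure stable under increasing unions of sets. This
  gives the step for unions in a Dynkin argument and later removes a truncation to compact sets.
\<close>

lemma Lp_closure_incseq_indicator:
  assumes D: "D \<subseteq> borel_measurable N" and p: "0 < p"
    and U: "\<And>n. U n \<in> sets N" "incseq U" "emeasure N (\<Union>n. U n) < \<infinity>"
    and c: "\<And>n::nat. (\<lambda>t. c * indicator (U n) t) \<in> Lp_closure N p D"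
  shows "(\<lambda>t. c * indicator (\<Union>n. U n) t) \<in> Lp_closure N p D"
proof (rule Lp_closure_limit[OF D _ _ c])
  let ?U = "\<Union>n. U n"
  have "(\<lambda>n. emeasure N (?U - U n)) \<longlonglongrightarrow> emeasure N (\<Inter>n. ?U - U n)"
  proof (rule Lim_emeasure_decseq)
    show "emeasure N (?U - U n) \<noteq> \<infinity>" for n
    proof -
      have "emeasure N (?U - U n) \<le> emeasure N ?U" using U(1) by (intro emeasure_mono) auto
      then show ?thesis using U(3) by auto
    qed
    show "decseq (\<lambda>n. ?U - U n)" using U(2) unfolding decseq_def incseq_def by blast
    show "range (\<lambda>n. ?U - U n) \<subseteq> sets N" using U(1) by blast
  qed
  moreover have "(\<Inter>n. ?U - U n) = {}" by auto
  ultimately have "(\<lambda>n. emeasure N (?U - U n)) \<longlonglongrightarrow> 0" by simp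
  then have "(\<lambda>n. ennreal (norm c powr p) * emeasure N (?U - U n)) \<longlonglongrightarrow> ennreal (norm c powr p) * 0"
    by (intro ennreal_tendsto_cmult) auto
  moreover have "ennreal (norm c powr p) * emeasure N (?U - U n)
      = Lp_modular N p (\<lambda>t. c * indicator ?U t - c * indicator (U n) t)" for n
  proof -
    have "(\<lambda>t. c * indicator (?U - U n) t) = (\<lambda>t. c * indicator ?U t - c * indicator (U n) t)"
      by (auto simp: indicator_def fun_eq_iff)
    moreover have "?U - U n \<in> sets N" using U(1) by auto
    ultimately show ?thesis using Lp_modular_mult_indicator[of "?U - U n" N p c] p by simp
  qed
  ultimately show "(\<lambda>n. Lp_modular N p (\<lambda>t. c * indicator ?U t - c * indicator (U n) t)) \<longlonglongrightarrow> 0"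
    by simp
  show "(\<lambda>t. c * indicator ?U t) \<in> borel_measurable N"
    using sets.countable_UN[of U UNIV N] U(1) by (intro borel_measurable_times borel_measurable_const borel_measurable_indicator) auto
  show "0 \<le> p" using p by simp
qed

lemma Lp_closure_sum:
  assumes D: "D \<subseteq> borel_measurable N" "\<And>d e. d \<in> D \<Longrightarrow> e \<in> D \<Longrightarrow> (\<lambda>t. d t + e t) \<in> D"
    and "0 \<le> p" and "(\<lambda>_. 0) \<in> Lp_closure N p D"
    and "finite I" and "\<And>i. i \<in> I \<Longrightarrow> f i \<in> Lp_closure N p D"
  shows "(\<lambda>t. \<Sum>i\<in>I. f i t) \<in> Lp_closure N p D"
  using assms(5,6)
proof (induction I rule: finite_induct)
  case empty
  then show ?case using assms(4) by simp
next
  case (insert i I)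
  have 1: "f i \<in> Lp_closure N p D" using insert.prems by blast
  have 2: "(\<lambda>t. \<Sum>i\<in>I. f i t) \<in> Lp_closure N p D" by (rule insert.IH, rule insert.prems) simp
  show ?case unfolding sum.insert[OF insert.hyps]
    by (rule Lp_closure_add[OF D \<open>0 \<le> p\<close> 1 2])
qed

text \<open>
  Indicators suffice: a measurable function is the pointwise limit of simple functions \<open>s i\<close> with
  \<open>|s i| \<le> 2 |f|\<close>, so \<open>|f - s i|\<^sup>p\<close> is dominated by \<open>3\<^sup>p |f|\<^sup>p\<close> and its integral tends to 0.
\<close>

lemma Lp_closure_of_finite_modular:
  assumes D: "D \<subseteq> borel_measurable N" "\<And>d e. d \<in> D \<Longrightarrow> e \<in> D \<Longrightarrow> (\<lambda>t. d t + e t) \<in> D"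
    and p: "0 < p"
    and ind: "\<And>A c. A \<in> sets N \<Longrightarrow> emeasure N A < \<infinity> \<Longrightarrow> (\<lambda>t. c * indicator A t) \<in> Lp_closure N p D"
    and f[measurable]: "f \<in> borel_measurable N" and fin: "Lp_modular N p f < \<infinity>"
    and space: "space N = UNIV"
  shows "f \<in> Lp_closure N p D"
proof -
  obtain s where s: "\<And>i. simple_function N (s i)" "\<And>x. (\<lambda>i. s i x) \<longlonglongrightarrow> f x"
    "\<And>i x. norm (s i x) \<le> 2 * norm (f x)"
    using borel_measurable_implies_sequence_metric[OF f, of 0] unfolding norm_conv_dist space
    by (metis UNIV_I)
  have sm[measurable]: "s i \<in> borel_measurable N" for i
    using s(1) by (rule borel_measurable_simple_function)
  have "s i \<in> Lp_closure N p D" for i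
  proof -
    have finY: "finite (range (s i))" using s(1)[of i] space by (simp add: simple_function_def)
    have "(\<lambda>t. y * indicator (s i -` {y}) t) \<in> Lp_closure N p D" if "y \<in> range (s i)" for y
    proof (cases "y = 0")
      case True
      then show ?thesis using ind[of "{}" 0] by simp
    next
      case False
      have m: "s i -` {y} \<in> sets N"
        using measurable_sets[OF sm, of "{y}" i] space by simp
      have "ennreal (norm y powr p) * emeasure N (s i -` {y}) \<le> Lp_modular N p (\<lambda>t. 2 * f t)"
        unfolding Lp_modular_mult_indicator[OF m p, symmetric] unfolding Lp_modular_def
        using s(3)[of i] p by (intro nn_integral_mono ennreal_leI powr_mono2) (auto simp: indicator_def norm_mult)
      also have "\<dots> = ennreal (2 powr p) * Lp_modular N p f"
        unfolding Lp_modular_def by (simp add: norm_mult powr_mult ennreal_mult nn_integral_cmult)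
      also have "\<dots> < \<infinity>" using fin by (simp add: ennreal_mult_less_top)
      finally have "emeasure N (s i -` {y}) < \<infinity>"
        using False by (auto simp: ennreal_mult_less_top)
      then show ?thesis using ind m by blast
    qed
    then have "(\<lambda>t. \<Sum>y\<in>range (s i). y * indicator (s i -` {y}) t) \<in> Lp_closure N p D"
      using p ind[of "{}" 0] by (intro Lp_closure_sum[OF D _ _ finY]) auto
    moreover have "(\<Sum>y\<in>range (s i). y * indicator (s i -` {y}) t) = s i t" for t
    proof -
      have "(\<Sum>y\<in>range (s i). y * indicator (s i -` {y}) t) = (\<Sum>y\<in>range (s i). if y = s i t then y else 0)"
        by (intro sum.cong) (auto simp: indicator_def)
      then show ?thesis using finY by simp
    qed
    ultimately show ?thesis by simp
  qed
  moreover have "(\<lambda>i. Lp_modular N p (\<lambda>t. f t - s i t)) \<longlonglongrightarrow> (\<integral>\<^sup>+t. 0 \<partial>N)"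
    unfolding Lp_modular_def
  proof (rule nn_integral_dominated_convergence[where w = "\<lambda>t. ennreal (3 powr p) * ennreal (norm (f t) powr p)"])
    have "norm (f t - s i t) powr p \<le> 3 powr p * norm (f t) powr p" for i t
    proof -
      have "norm (f t - s i t) \<le> 3 * norm (f t)"
        using norm_triangle_ineq4[of "f t" "s i t"] s(3)[of i t] by linarith
      then have "norm (f t - s i t) powr p \<le> (3 * norm (f t)) powr p" using p by (intro powr_mono2) auto
      then show ?thesis by (simp add: powr_mult)
    qed
    then show "AE t in N. ennreal (norm (f t - s i t) powr p) \<le> ennreal (3 powr p) * ennreal (norm (f t) powr p)" for i
      by (simp flip: ennreal_mult)
    show "(\<integral>\<^sup>+t. ennreal (3 powr p) * ennreal (norm (f t) powr p) \<partial>N) < \<infinity>"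
      using fin unfolding Lp_modular_def by (simp add: nn_integral_cmult ennreal_mult_less_top)
    have "(\<lambda>i. norm (f t - s i t) powr p) \<longlonglongrightarrow> 0" for t
    proof -
      have "(\<lambda>i. norm (f t - s i t)) \<longlonglongrightarrow> 0"
        using tendsto_diff[OF tendsto_const[of "f t"] s(2)[of t]] by (intro tendsto_norm_zero) simp
      then show ?thesis using p by (intro tendsto_zero_powrI[OF _ tendsto_const]) auto
    qed
    then show "AE t in N. (\<lambda>i. ennreal (norm (f t - s i t) powr p)) \<longlonglongrightarrow> 0"
      by (intro AE_I2 tendsto_ennrealI[of _ 0, unfolded ennreal_0])
  qed auto
  ultimately show ?thesis using p by (intro Lp_closure_limit[OF D(1) _ f, of _ s]) auto
qed

text \<open>
  The countable family consists of the finite sums of \<open>c\<close> times the indicator of \<open>B \<inter> L k\<close>, where \<open>c\<close>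
  runs through a countable dense set of scalars, \<open>B\<close> through the finite intersections of basic open sets
  and \<open>L k\<close> through a compact exhaustion. Because the sets \<open>B\<close> generate the Borel sets and are stable
  under intersection, a Dynkin argument inside each \<open>L k\<close> reaches the indicators of all Borel sets.
  The measure may live on a larger sigma-algebra than the Borel sets as long as each of its sets
  agrees almost everywhere with a Borel set.
\<close>

lemma countable_dense_family:
  fixes N :: "'g::{t2_space, second_countable_topology} measure"
  assumes lc: "locally compact (UNIV :: 'g set)" and p: "0 < p"
    and borel: "sets borel \<subseteq> sets N"
    and ae: "\<And>A. A \<in> sets N \<Longrightarrow> \<exists>B\<in>sets borel. AE t in N. t \<in> A \<longleftrightarrow> t \<in> B"
    and fin: "\<And>C. compact C \<Longrightarrow> emeasure N C < \<infinity>"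
  obtains D where "countable D" "D \<noteq> {}"
    "\<And>d. d \<in> D \<Longrightarrow> d \<in> borel_measurable borel"
    "\<And>d. d \<in> D \<Longrightarrow> \<exists>C M. compact C \<and> 0 \<le> M \<and> (\<forall>t. norm (d t) \<le> M * indicator C t)"
    "\<And>f. f \<in> borel_measurable N \<Longrightarrow> Lp_modular N p f < \<infinity> \<Longrightarrow> f \<in> Lp_closure N p D"
proof -
  have space: "space N = UNIV"
    using borel sets.sets_into_space[of UNIV N] by (auto simp: subset_iff)
  have meas_borel: "borel_measurable borel \<subseteq> borel_measurable N"
    by (rule subsetI, rule measurable_mono[THEN subsetD]) (use borel space in auto)
  obtain L :: "nat \<Rightarrow> 'g set" where L: "\<And>n. compact (L n)" "incseq L" "(\<Union>n. L n) = UNIV"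
    using countable_compact_cover[OF lc] by metis
  obtain B :: "'g set set" where B: "countable B" "topological_basis B"
    using ex_countable_basis by auto
  obtain Q :: "complex set" where Q: "countable Q" "\<And>X. open X \<Longrightarrow> X \<noteq> {} \<Longrightarrow> \<exists>d\<in>Q. d \<in> X"
    using countable_dense_setE by blast
  define G where "G = Inter ` {b. finite b \<and> b \<subseteq> B}"
  have G: "countable G" unfolding G_def by (intro countable_image countable_Collect_finite_subset B)
  have openB: "\<And>b. b \<in> B \<Longrightarrow> open b" using B by (simp add: topological_basis_open)
  then have openG: "\<And>g. g \<in> G \<Longrightarrow> open g" unfolding G_def by auto
  have BG: "B \<subseteq> G" unfolding G_def by (force intro: image_eqI[of _ _ "{_}"])
  have sigma: "sigma_sets UNIV G = sets borel"
  proof -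
    have "sets (borel :: 'g measure) = sigma_sets UNIV B"
      unfolding borel_eq_countable_basis[OF B] by (intro sets_measure_of) auto
    moreover have "sigma_sets UNIV B \<subseteq> sigma_sets UNIV G" using BG by (rule sigma_sets_mono')
    moreover have "sigma_sets UNIV G \<subseteq> sets borel"
      using sets.sigma_sets_subset[of G "borel :: 'g measure"] borel_open[OF openG] by auto
    ultimately show ?thesis by blast
  qed
  have stable: "Int_stable G"
  proof (rule Int_stableI)
    fix a b assume "a \<in> G" "b \<in> G"
    then obtain a' b' where "a = \<Inter>a'" "b = \<Inter>b'" "finite a'" "finite b'" "a' \<subseteq> B" "b' \<subseteq> B"
      by (auto simp: G_def)
    then show "a \<inter> b \<in> G" unfolding G_def by (intro image_eqI[of _ _ "a' \<union> b'"]) auto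
  qed
  define \<B> where "\<B> = (\<lambda>(g, k). g \<inter> L k) ` (G \<times> UNIV)"
  have \<B>: "countable \<B>" unfolding \<B>_def using G by simp
  have Lm: "L k \<in> sets borel" for k using L(1) by (simp add: borel_compact)
  have \<B>m: "A \<in> sets borel" if "A \<in> \<B>" for A
    using that openG Lm by (auto simp: \<B>_def)
  define val :: "(complex \<times> 'g set) list \<Rightarrow> 'g \<Rightarrow> complex"
    where "val xs = (\<lambda>t. \<Sum>(c, A)\<leftarrow>xs. c * indicator A t)" for xs
  define D where "D = val ` lists (Q \<times> \<B>)"
  have D1: "countable D" unfolding D_def using Q \<B> by (intro countable_image countable_lists) auto
  have D2: "D \<noteq> {}" unfolding D_def by auto
  have D3: "d \<in> borel_measurable borel" if "d \<in> D" for d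
  proof -
    obtain xs where "d = val xs" "set xs \<subseteq> Q \<times> \<B>" using \<open>d \<in> D\<close> by (auto simp: D_def)
    moreover have "set xs \<subseteq> Q \<times> \<B> \<Longrightarrow> val xs \<in> borel_measurable borel"
    proof (induction xs)
      case Nil
      then show ?case by (simp add: val_def)
    next
      case (Cons x xs)
      obtain c A where x: "x = (c, A)" by (cases x)
      then have [measurable]: "A \<in> sets borel" "val xs \<in> borel_measurable borel" using Cons \<B>m by auto
      have "val (x # xs) = (\<lambda>t. c * indicator A t + val xs t)" by (simp add: val_def x)
      then show ?case by simp
    qed
    ultimately show ?thesis by simp
  qed
  then have DN: "D \<subseteq> borel_measurable N" using meas_borel by blast
  have D4: "\<exists>C M. compact C \<and> 0 \<le> M \<and> (\<forall>t. norm (d t) \<le> M * indicator C t)" if "d \<in> D" for d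
  proof -
    obtain xs where "d = val xs" "set xs \<subseteq> Q \<times> \<B>" using \<open>d \<in> D\<close> by (auto simp: D_def)
    moreover have "set xs \<subseteq> Q \<times> \<B> \<Longrightarrow> \<exists>C M. compact C \<and> 0 \<le> M \<and> (\<forall>t. norm (val xs t) \<le> M * indicator C t)"
    proof (induction xs)
      case Nil
      then show ?case by (auto simp: val_def intro!: exI[of _ "{}"])
    next
      case (Cons x xs)
      obtain c A where x: "x = (c, A)" by (cases x)
      then obtain k where k: "A \<subseteq> L k" using Cons by (auto simp: \<B>_def)
      obtain C M where CM: "compact C" "0 \<le> M" "\<And>t. norm (val xs t) \<le> M * indicator C t"
        using Cons by auto
      have "norm (val (x # xs) t) \<le> (norm c + M) * indicator (C \<union> L k) t" for t
      proof -
        have "norm (val (x # xs) t) \<le> norm (c * indicator A t) + norm (val xs t)"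
          by (simp add: val_def x norm_triangle_ineq)
        also have "\<dots> \<le> norm c * indicator (C \<union> L k) t + M * indicator (C \<union> L k) t"
        proof (intro add_mono)
          show "norm (c * indicator A t) \<le> norm c * indicator (C \<union> L k) t"
            using k by (auto simp: indicator_def)
          show "norm (val xs t) \<le> M * indicator (C \<union> L k) t"
            using CM(2) CM(3)[of t] by (cases "t \<in> C") auto
        qed
        finally show ?thesis by (simp add: distrib_right)
      qed
      then show ?case using CM L(1) by (intro exI[of _ "C \<union> L k"] exI[of _ "norm c + M"]) auto
    qed
    ultimately show ?thesis by simp
  qed
  have Dadd: "(\<lambda>t. d t + e t) \<in> D" if de: "d \<in> D" "e \<in> D" for d e
  proof -
    obtain xs ys where "d = val xs" "e = val ys" "xs \<in> lists (Q \<times> \<B>)" "ys \<in> lists (Q \<times> \<B>)"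
      using de unfolding D_def by blast
    then have "(\<lambda>t. d t + e t) = val (xs @ ys)" "xs @ ys \<in> lists (Q \<times> \<B>)"
      by (auto simp: val_def)
    then show ?thesis unfolding D_def by blast
  qed
  have finL: "emeasure N (A \<inter> L k) < \<infinity>" for A k
    using fin[OF L(1)[of k]] emeasure_mono[of "A \<inter> L k" "L k" N] Lm borel by (auto intro: le_less_trans)
  have indB: "(\<lambda>t. c * indicator A t) \<in> Lp_closure N p D" if A: "A \<in> \<B>" for A c
    unfolding Lp_closure_def
  proof safe
    have [measurable]: "A \<in> sets N" using A \<B>m borel by auto
    show "(\<lambda>t. c * indicator A t) \<in> borel_measurable N" by measurable
    fix \<epsilon> :: real assume \<epsilon>: "0 < \<epsilon>"
    have "emeasure N A < \<infinity>" using A finL by (auto simp: \<B>_def)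
    then obtain a where a: "emeasure N A = ennreal a" "0 \<le> a" by (cases "emeasure N A") auto
    define r where "r = (\<epsilon> / (a + 1)) powr (1 / p)"
    have "0 < r" using \<epsilon> a by (simp add: r_def)
    then obtain q where q: "q \<in> Q" "q \<in> ball c r" using Q(2)[of "ball c r"] by auto
    have "norm (c - q) powr p \<le> r powr p" using q p by (intro powr_mono2) (auto simp: dist_norm)
    also have "\<dots> = \<epsilon> / (a + 1)" using p \<epsilon> a by (simp add: r_def powr_powr)
    finally have "norm (c - q) powr p * a \<le> \<epsilon> / (a + 1) * a" using a by (intro mult_right_mono)
    also have "\<dots> < \<epsilon>" using \<epsilon> a by (simp add: field_simps)
    finally have "Lp_modular N p (\<lambda>t. (c - q) * indicator A t) < ennreal \<epsilon>"
      using p a by (simp add: Lp_modular_mult_indicator ennreal_less_iff flip: ennreal_mult)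
    moreover have "(\<lambda>t. (c - q) * indicator A t) = (\<lambda>t. c * indicator A t - val [(q, A)] t)"
      by (auto simp: val_def algebra_simps)
    ultimately show "\<exists>d\<in>D. Lp_modular N p (\<lambda>t. c * indicator A t - d t) < ennreal \<epsilon>"
      unfolding D_def using q A by (intro bexI[of _ "val [(q, A)]"] imageI) auto
  qed
  have UNIV_G: "UNIV \<in> G" unfolding G_def by (intro image_eqI[of _ _ "{}"]) auto
  have G_\<B>: "g \<inter> L k \<in> \<B>" if "g \<in> G" for g k using that by (auto simp: \<B>_def)
  have zero: "(\<lambda>t. 0) \<in> Lp_closure N p D"
    using indB[OF G_\<B>[OF UNIV_G], of 0] by simp
  have p0: "0 \<le> p" using p by simp
  (* All scalars c are carried along in the induction, since the complement needs the scalar -c. *)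
  have trunc: "\<forall>c. (\<lambda>t. c * indicator (A \<inter> L k) t) \<in> Lp_closure N p D" if A: "A \<in> sets borel" for A k
    using stable subset_UNIV[of G, folded Pow_UNIV] A[folded sigma]
  proof (induction A rule: sigma_sets_induct_disjoint)
    case (basic A)
    then show ?case by (intro allI indB G_\<B>)
  next
    case empty
    then show ?case using zero by simp
  next
    case (compl A)
    have "(\<lambda>t. c * indicator (UNIV \<inter> L k) t + (- c) * indicator (A \<inter> L k) t) \<in> Lp_closure N p D" for c
      by (rule Lp_closure_add[OF DN Dadd p0 indB[OF G_\<B>[OF UNIV_G]] compl(2)[rule_format]])
    moreover have "(\<lambda>t. c * indicator (UNIV \<inter> L k) t + (- c) * indicator (A \<inter> L k) t)
        = (\<lambda>t. c * indicator ((UNIV - A) \<inter> L k) t)" for c :: complex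
      by (rule ext) (auto simp: indicator_def)
    ultimately show ?case by metis
  next
    case (union A)
    have Am: "A i \<in> sets N" for i using union(2) borel unfolding sigma by blast
    define V where "V n = (\<Union>i<n. A i) \<inter> L k" for n
    have V: "(\<lambda>t. c * indicator (V n) t) \<in> Lp_closure N p D" for n c
    proof (induction n)
      case 0
      then show ?case using zero by (simp add: V_def)
    next
      case (Suc n)
      have "(\<lambda>t. c * indicator (V n) t + c * indicator (A n \<inter> L k) t) \<in> Lp_closure N p D"
        by (rule Lp_closure_add[OF DN Dadd p0 Suc union(3)[rule_format]])
      moreover have "(\<lambda>t. c * indicator (V n) t + c * indicator (A n \<inter> L k) t) = (\<lambda>t. c * indicator (V (Suc n)) t)"
      proof
        fix t
        have "V n \<inter> (A n \<inter> L k) = {}"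
        proof -
          have "A i \<inter> A n = {}" if "i < n" for i
            using that by (intro disjoint_family_onD[OF union(1)]) auto
          then show ?thesis unfolding V_def by blast
        qed
        moreover have "V (Suc n) = V n \<union> (A n \<inter> L k)" by (auto simp: V_def less_Suc_eq)
        ultimately show "c * indicator (V n) t + c * indicator (A n \<inter> L k) t = c * indicator (V (Suc n)) t"
          by (auto simp: indicator_def)
      qed
      ultimately show ?case by metis
    qed
    have UV: "(\<Union>n. V n) = (\<Union>i. A i) \<inter> L k" by (auto simp: V_def)
    show ?case unfolding UV[symmetric]
    proof (rule allI, rule Lp_closure_incseq_indicator[OF DN p _ _ _ V])
      show "V n \<in> sets N" for n unfolding V_def using Am Lm[of k] borel by (intro sets.Int sets.finite_UN) auto
      show "incseq V" by (intro incseq_SucI) (auto simp: V_def less_Suc_eq)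
      show "emeasure N (\<Union>n. V n) < \<infinity>" unfolding UV by (rule finL)
    qed
  qed
  have ind: "(\<lambda>t. c * indicator A t) \<in> Lp_closure N p D" if A: "A \<in> sets N" "emeasure N A < \<infinity>" for A c
  proof -
    obtain A' where A': "A' \<in> sets borel" "AE t in N. t \<in> A \<longleftrightarrow> t \<in> A'" using ae A by blast
    have eq: "(\<Union>k. A' \<inter> L k) = A'" using L(3) by auto
    have eq_measure: "emeasure N A' = emeasure N A"
    proof (rule emeasure_eq_AE)
      show "AE t in N. t \<in> A' \<longleftrightarrow> t \<in> A" using A'(2) by eventually_elim simp
    qed (use A(1) A'(1) borel in blast)+
    have "(\<lambda>t. c * indicator (\<Union>k. A' \<inter> L k) t) \<in> Lp_closure N p D"
    proof (rule Lp_closure_incseq_indicator[OF DN p])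
      show "A' \<inter> L k \<in> sets N" for k using A'(1) Lm[of k] borel by blast
      show "incseq (\<lambda>k. A' \<inter> L k)" using L(2) unfolding incseq_def by blast
      show "emeasure N (\<Union>k. A' \<inter> L k) < \<infinity>" using eq_measure A(2) eq by simp
      show "(\<lambda>t. c * indicator (A' \<inter> L k) t) \<in> Lp_closure N p D" for k
        by (rule trunc[OF A'(1), rule_format])
    qed
    then have closure: "(\<lambda>t. c * indicator A' t) \<in> Lp_closure N p D" unfolding eq .
    have "AE t in N. c * indicator A' t = c * indicator A t"
      using A'(2) by eventually_elim (simp add: indicator_def)
    moreover have "(\<lambda>t. c * indicator A t) \<in> borel_measurable N"
      using A(1) by measurable
    ultimately show ?thesis by (rule Lp_closure_cong_AE[OF DN p closure, rotated])
  qed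
  show ?thesis
  proof (rule that[OF D1 D2 D3 D4])
    fix f assume f: "f \<in> borel_measurable N" "Lp_modular N p f < \<infinity>"
    show "f \<in> Lp_closure N p D"
      by (rule Lp_closure_of_finite_modular[OF DN Dadd p ind f space])
  qed
qed

section \<open>Absolute continuity and inner approximation by compact sets\<close>

text \<open>
  If sets of \<open>M\<close>-measure below \<open>2\<^sup>-\<^sup>n\<close> had \<open>N\<close>-measure at least \<open>\<epsilon>\<close>, their upper limit would be \<open>M\<close>-null
  by Borel--Cantelli but would have \<open>N\<close>-measure at least \<open>\<epsilon>\<close>. The latter needs continuity from above,
  hence sets inside one \<open>F\<close> of finite \<open>N\<close>-measure.
\<close>

lemma absolutely_continuous_epsilon_delta:
  fixes \<epsilon> :: real
  assumes ac: "absolutely_continuous M N" and sets: "sets N = sets M"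
    and F: "F \<in> sets M" "emeasure N F < \<infinity>" and "0 < \<epsilon>"
  obtains \<delta> :: real where "0 < \<delta>"
    "\<And>A. A \<in> sets M \<Longrightarrow> A \<subseteq> F \<Longrightarrow> emeasure M A < ennreal \<delta> \<Longrightarrow> emeasure N A < ennreal \<epsilon>"
proof -
  have "\<exists>\<delta>>0. \<forall>A. A \<in> sets M \<longrightarrow> A \<subseteq> F \<longrightarrow> emeasure M A < ennreal \<delta> \<longrightarrow> emeasure N A < ennreal \<epsilon>"
  proof (rule ccontr)
    assume "\<not> ?thesis"
    then have "\<exists>A. A \<in> sets M \<and> A \<subseteq> F \<and> emeasure M A < ennreal \<delta> \<and> ennreal \<epsilon> \<le> emeasure N A" if "0 < \<delta>" for \<delta>
      using that by (meson not_less)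
    then have "\<exists>A. A \<in> sets M \<and> A \<subseteq> F \<and> emeasure M A < ennreal ((1/2)^n) \<and> ennreal \<epsilon> \<le> emeasure N A" for n :: nat
      by simp
    then obtain A where A: "\<And>n. A n \<in> sets M" "\<And>n. A n \<subseteq> F"
      "\<And>n. emeasure M (A n) < ennreal ((1/2)^n)" "\<And>n. ennreal \<epsilon> \<le> emeasure N (A n)"
      by metis
    have "limsup A \<in> null_sets M"
    proof (rule borel_cantelli_limsup1[OF A(1)])
      show "emeasure M (A n) < \<infinity>" for n using A(3)[of n] by (auto intro: less_trans)
      show "summable (\<lambda>n. measure M (A n))"
      proof (rule summable_comparison_test'[OF summable_geometric, of "1/2" 0])
        show "norm (measure M (A n)) \<le> (1/2)^n" for n
          using A(3)[of n] by (simp add: measure_def enn2real_leI)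
      qed simp
    qed
    then have "emeasure N (limsup A) = 0"
      using ac by (auto simp: absolutely_continuous_def null_sets_def)
    moreover have "emeasure N (limsup A) \<ge> ennreal \<epsilon>"
    proof -
      define V where "V n = (\<Union>k\<in>{n..}. A k)" for n
      have V: "V n \<in> sets N" "V n \<subseteq> F" for n using A(1,2) sets by (auto simp: V_def)
      have "limsup A = (\<Inter>n. V n)" unfolding limsup_INF_SUP V_def by simp
      moreover have "(\<lambda>n. emeasure N (V n)) \<longlonglongrightarrow> emeasure N (\<Inter>n. V n)"
      proof (rule Lim_emeasure_decseq)
        show "range V \<subseteq> sets N" using V by auto
        show "decseq V" unfolding decseq_def V_def by (intro allI impI UN_mono) auto
        show "emeasure N (V n) \<noteq> \<infinity>" for n
          using emeasure_mono[OF V(2)[of n], of N] F sets by auto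
      qed
      moreover have "ennreal \<epsilon> \<le> emeasure N (V n)" for n
      proof -
        have "A n \<subseteq> V n" by (auto simp: V_def)
        then show ?thesis using A(4)[of n] emeasure_mono[of "A n" "V n" N] V(1)[of n] by (auto intro: order_trans)
      qed
      ultimately show ?thesis by (intro LIMSEQ_le_const) auto
    qed
    ultimately show False using \<open>0 < \<epsilon>\<close> by (auto simp: ennreal_eq_0_iff)
  qed
  then show thesis using that by blast
qed

text \<open>
  Inner approximation inside a compact set comes from outer regularity: remove from \<open>F\<close> an open set
  that covers \<open>F - E\<close> and has almost the same measure.
\<close>

lemma compact_inner_approximation:
  fixes \<mu> :: "'g::t2_space measure"
  assumes borel: "sets \<mu> = sets borel"
    and outer: "\<And>A. A \<in> sets borel \<Longrightarrow> emeasure \<mu> A = (INF U\<in>{U. open U \<and> A \<subseteq> U}. emeasure \<mu> U)"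
    and F: "compact F" and E: "E \<in> sets (completion \<mu>)"
    and less: "emeasure (completion \<mu>) (F - E) < \<delta>"
  obtains K where "compact K" "K \<subseteq> F" "K \<subseteq> E" "emeasure \<mu> (F - K) < \<delta>"
proof -
  have Fm: "F \<in> sets \<mu>" using F borel by (simp add: borel_compact)
  then have "F - E \<in> sets (completion \<mu>)" using E by auto
  then obtain N where N: "F - E \<subseteq> N" "N \<in> sets \<mu>" "emeasure (completion \<mu>) (F - E) = emeasure \<mu> N"
    by (rule completion_upper)
  then have "(INF U\<in>{U. open U \<and> N \<subseteq> U}. emeasure \<mu> U) < \<delta>"
    using less outer[of N] borel by simp
  then obtain U where U: "open U" "N \<subseteq> U" "emeasure \<mu> U < \<delta>"
    by (auto simp: INF_less_iff)
  show thesis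
  proof
    show "compact (F - U)" using F U(1) by (intro compact_diff)
    show "F - U \<subseteq> E" using N(1) U(2) by blast
    have "emeasure \<mu> (F - (F - U)) \<le> emeasure \<mu> U"
      using U(1) borel by (intro emeasure_mono) auto
    then show "emeasure \<mu> (F - (F - U)) < \<delta>" using U(3) by simp
  qed auto
qed

section \<open>Disjoint translates\<close>

lemma compact_translation_image:
  fixes K :: "'g::topological_group_add set"
  assumes "compact K"
  shows "compact ((\<lambda>x. s + x) ` K)"
  using assms by (intro compact_continuous_image continuous_intros)

lemma borel_measurable_translation:
  "(\<lambda>x. s + x) \<in> borel_measurable (borel :: 'g::topological_group_add measure)"
  by (intro borel_measurable_continuous_onI continuous_intros)

lemma translation_image_eq_vimage:
  fixes s :: "'g::group_add"
  shows "(\<lambda>x. s + x) ` A = (\<lambda>x. - s + x) -` A"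
proof (intro set_eqI iffI)
  fix x assume "x \<in> (\<lambda>x. - s + x) -` A"
  then have "- s + x \<in> A" by simp
  then show "x \<in> (\<lambda>x. s + x) ` A" by (intro image_eqI[of _ _ "- s + x"]) (auto simp: add.assoc[symmetric])
qed (auto simp: add.assoc[symmetric])

text \<open>
  If \<open>Q\<close> is the union of the translates chosen so far, then \<open>- s + F n\<close> meets \<open>Q\<close> only if \<open>s\<close> lies in
  \<open>F n - Q\<close>, a compact set. So a requirement that can be met outside every compact set can be met with
  disjoint translates.
\<close>

lemma disjoint_translates_choice:
  fixes F :: "nat \<Rightarrow> 'g::topological_group_add set"
  assumes F: "\<And>n. compact (F n)"
    and ex: "\<And>n C. compact C \<Longrightarrow> \<exists>s. s \<notin> C \<and> P n s"
  obtains s where "\<And>n. P n (s n)" "disjoint_family (\<lambda>n. (\<lambda>x. - s n + x) ` F n)"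
proof -
  define R where "R n s = (\<lambda>x. - s + x) ` F n" for n and s :: 'g
  (* The state pairs the element chosen last with a compact set that contains all translates so far. *)
  have "\<exists>f. \<forall>n. (P n (fst (f n)) \<and> compact (snd (f n)) \<and> R n (fst (f n)) \<subseteq> snd (f n)) \<and>
    (snd (f n) \<subseteq> snd (f (Suc n)) \<and> snd (f n) \<inter> R (Suc n) (fst (f (Suc n))) = {})"
  proof (rule dependent_nat_choice)
    obtain s where "P 0 s" using ex[of "{}" 0] by auto
    then show "\<exists>f. P 0 (fst f) \<and> compact (snd f) \<and> R 0 (fst f) \<subseteq> snd f"
      using compact_translation_image[OF F] by (intro exI[of _ "(s, R 0 s)"]) (auto simp: R_def)
  next
    fix f n assume f: "P n (fst f) \<and> compact (snd f) \<and> R n (fst f) \<subseteq> snd f"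
    have "compact ((\<lambda>(x, q). x + - q) ` (F (Suc n) \<times> snd f))"
      unfolding case_prod_unfold using f F by (intro compact_continuous_image compact_Times continuous_intros) auto
    from ex[OF this] obtain s where s: "s \<notin> (\<lambda>(x, q). x + - q) ` (F (Suc n) \<times> snd f)" "P (Suc n) s"
      by blast
    have "snd f \<inter> R (Suc n) s = {}"
    proof (rule ccontr)
      assume "snd f \<inter> R (Suc n) s \<noteq> {}"
      then obtain x where x: "x \<in> F (Suc n)" "- s + x \<in> snd f" by (auto simp: R_def)
      have "s = x + - (- s + x)" by (simp add: minus_add add.assoc[symmetric])
      then have "s \<in> (\<lambda>(x, q). x + - q) ` (F (Suc n) \<times> snd f)"
        using x by (intro image_eqI[of _ _ "(x, - s + x)"]) auto
      then show False using s(1) by contradiction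
    qed
    then show "\<exists>g. (P (Suc n) (fst g) \<and> compact (snd g) \<and> R (Suc n) (fst g) \<subseteq> snd g) \<and>
        (snd f \<subseteq> snd g \<and> snd f \<inter> R (Suc n) (fst g) = {})"
      using f s(2) compact_translation_image[OF F]
      by (intro exI[of _ "(s, snd f \<union> R (Suc n) s)"]) (auto simp: R_def)
  qed
  then obtain f where f: "\<And>n. P n (fst (f n))" "\<And>n. R n (fst (f n)) \<subseteq> snd (f n)"
    "\<And>n. snd (f n) \<subseteq> snd (f (Suc n))" "\<And>n. snd (f n) \<inter> R (Suc n) (fst (f (Suc n))) = {}"
    by blast
  have "R m (fst (f m)) \<inter> R n (fst (f n)) = {}" if "m < n" for m n
  proof -
    obtain k where k: "n = Suc k" "m \<le> k" using \<open>m < n\<close> less_Suc_eq_le by (metis lessE)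
    have "snd (f m) \<subseteq> snd (f k)" using f(3) k(2) by (rule lift_Suc_mono_le)
    then show ?thesis using f(2)[of m] f(4)[of k] k(1) by blast
  qed
  then have "disjoint_family (\<lambda>n. R n (fst (f n)))"
    unfolding disjoint_family_on_def by (metis Int_commute nat_neq_iff)
  then show thesis using f(1) that[of "\<lambda>n. fst (f n)"] by (simp add: R_def)
qed

lemma Lp_modular_disjoint_sum_le:
  fixes h :: "nat \<Rightarrow> 'a \<Rightarrow> complex"
  assumes E: "\<And>j. E j \<in> sets N" "disjoint_family E"
    and h: "\<And>j t. norm (h j t) \<le> c j * indicator (E j) t" and p: "0 < p"
  shows "Lp_modular N p (\<lambda>t. \<Sum>j. h j t) \<le> (\<Sum>j. ennreal (c j powr p) * emeasure N (E j))"
proof -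
  have "ennreal (norm (\<Sum>j. h j t) powr p) \<le> (\<Sum>j. ennreal (c j powr p) * indicator (E j) t)" for t
  proof (cases "\<exists>i. t \<in> E i")
    case True
    then obtain i where i: "t \<in> E i" by auto
    have "h j t = 0" if "j \<noteq> i" for j
    proof -
      have "t \<notin> E j" using E(2) i that by (auto simp: disjoint_family_on_def)
      then show ?thesis using h[of j t] by simp
    qed
    then have "(\<Sum>j. h j t) = h i t" using suminf_finite[of "{i}" "\<lambda>j. h j t"] by auto
    then have "ennreal (norm (\<Sum>j. h j t) powr p) \<le> ennreal (c i powr p) * indicator (E i) t"
      using h[of i t] i p by (auto intro!: ennreal_leI powr_mono2)
    also have "\<dots> \<le> (\<Sum>j. ennreal (c j powr p) * indicator (E j) t)"
    proof -
      define f where "f j = ennreal (c j powr p) * indicator (E j) t" for j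
      have "f i \<le> (\<Sum>j. f j)" using sum_le_suminf[of f "{i}"] by simp
      then show ?thesis by (simp only: f_def)
    qed
    finally show ?thesis .
  next
    case False
    then have "h j t = 0" for j using h[of j t] by simp
    then show ?thesis by simp
  qed
  then have "Lp_modular N p (\<lambda>t. \<Sum>j. h j t) \<le> (\<integral>\<^sup>+t. (\<Sum>j. ennreal (c j powr p) * indicator (E j) t) \<partial>N)"
    unfolding Lp_modular_def by (intro nn_integral_mono)
  also have "\<dots> = (\<Sum>j. ennreal (c j powr p) * emeasure N (E j))"
    using E(1) by (simp add: nn_integral_suminf nn_integral_cmult_indicator)
  finally show ?thesis .
qed

section \<open>The weighted measure on the group\<close>

locale weighted_haar =
  fixes \<mu> :: "'g :: {topological_group_add, t2_space, second_countable_topology} measure"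
    and p :: real and \<omega> :: "'g \<Rightarrow> real"
  assumes locally_compact: "locally compact (UNIV :: 'g set)"
    and haar: "left_haar_measure \<mu>"
    and p_ge_1: "1 \<le> p"
    and weight: "weight (completion \<mu>) p \<omega>"
begin

abbreviation M :: "'g measure" where "M \<equiv> completion \<mu>"

definition \<nu> :: "'g measure" where "\<nu> = density M (\<lambda>t. ennreal (\<omega> t powr p))"

lemma p_pos: "0 < p" and p_nonneg: "0 \<le> p"
  using p_ge_1 by auto

lemma sets_\<mu>: "sets \<mu> = sets borel"
  using haar by (simp add: left_haar_measure_def)

lemma space_\<mu>: "space \<mu> = UNIV"
  using sets_eq_imp_space_eq[OF sets_\<mu>] by simp

lemma sets_\<nu>: "sets \<nu> = sets M"
  by (simp add: \<nu>_def)

lemma borel_in_M: "A \<in> sets borel \<Longrightarrow> A \<in> sets M"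
  using sets_\<mu> by auto

lemma compact_in_M: "compact K \<Longrightarrow> K \<in> sets M"
  by (intro borel_in_M borel_compact)

lemma emeasure_M_borel: "A \<in> sets borel \<Longrightarrow> emeasure M A = emeasure \<mu> A"
  using sets_\<mu> by simp

lemma measurable_\<nu>: "borel_measurable \<nu> = borel_measurable M"
  by (rule measurable_cong_sets) (simp_all add: sets_\<nu>)

lemma borel_measurable_M: "h \<in> borel_measurable borel \<Longrightarrow> h \<in> borel_measurable M"
  by (rule measurable_completion) (simp add: measurable_cong_sets[OF sets_\<mu> refl])

lemma weight_measurable [measurable]: "\<omega> \<in> borel_measurable M"
  and weight_pos: "0 < \<omega> t"
  using weight by (auto simp: weight_def)

lemma emeasure_\<nu>: "A \<in> sets M \<Longrightarrow> emeasure \<nu> A = (\<integral>\<^sup>+t\<in>A. ennreal (\<omega> t powr p) \<partial>M)"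
  unfolding \<nu>_def by (intro emeasure_density) measurable

lemma emeasure_\<nu>_compact: "compact K \<Longrightarrow> emeasure \<nu> K < \<infinity>"
  using weight by (simp add: emeasure_\<nu> compact_in_M weight_def)

lemma emeasure_\<mu>_compact: "compact K \<Longrightarrow> emeasure \<mu> K < \<infinity>"
  using haar by (simp add: left_haar_measure_def)

lemma emeasure_M_compact: "compact K \<Longrightarrow> emeasure M K < \<infinity>"
  unfolding emeasure_M_borel[OF borel_compact] by (rule emeasure_\<mu>_compact)

lemma translation_invariant:
  assumes "A \<in> sets borel"
  shows "emeasure \<mu> ((\<lambda>x. s + x) ` A) = emeasure \<mu> A"
proof -
  have "\<forall>s. \<forall>A\<in>sets borel. emeasure \<mu> ((\<lambda>x. s + x) ` A) = emeasure \<mu> A"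
    using haar unfolding left_haar_measure_def by (elim conjE)
  then show ?thesis using assms by (elim allE ballE) auto
qed

text \<open>Since the weight is strictly positive, \<open>M\<close> and \<open>\<nu>\<close> have the same null sets.\<close>

lemma ac_M_\<nu>: "absolutely_continuous M \<nu>"
  unfolding \<nu>_def by (intro absolutely_continuousI_density) measurable

lemma ac_\<nu>_M: "absolutely_continuous \<nu> M"
proof -
  have "A \<in> null_sets M" if "A \<in> null_sets \<nu>" for A
  proof -
    have A: "A \<in> sets M" "AE t in M. t \<in> A \<longrightarrow> ennreal (\<omega> t powr p) = 0"
      using that unfolding \<nu>_def by (auto simp: null_sets_density_iff)
    have "AE t in M. t \<notin> A" using A(2)
    proof eventually_elim
      case (elim t)
      have "0 < \<omega> t powr p" using weight_pos[of t] by simp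
      then show ?case using elim by (auto simp: ennreal_eq_0_iff)
    qed
    then show ?thesis using A(1) by (simp add: AE_iff_null_sets)
  qed
  then show ?thesis by (auto simp: absolutely_continuous_def)
qed

lemma Lp_modular_\<nu>:
  assumes [measurable]: "h \<in> borel_measurable M"
  shows "Lp_modular \<nu> p h = (\<integral>\<^sup>+t. ennreal ((norm (h t) * \<omega> t) powr p) \<partial>M)"
proof -
  have "Lp_modular \<nu> p h = (\<integral>\<^sup>+t. ennreal (\<omega> t powr p) * ennreal (norm (h t) powr p) \<partial>M)"
    unfolding Lp_modular_def \<nu>_def by (intro nn_integral_density) measurable
  also have "\<dots> = (\<integral>\<^sup>+t. ennreal ((norm (h t) * \<omega> t) powr p) \<partial>M)"
    using weight_pos by (intro nn_integral_cong) (simp add: powr_mult less_imp_le mult.commute flip: ennreal_mult)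
  finally show ?thesis .
qed

lemma Lp_space_iff:
  "h \<in> Lp_space M p \<omega> \<longleftrightarrow> h \<in> borel_measurable M \<and> Lp_modular \<nu> p h < \<infinity>"
proof (cases "h \<in> borel_measurable M")
  case [measurable]: True
  have "integrable M (\<lambda>t. (norm (h t) * \<omega> t) powr p) \<longleftrightarrow> Lp_modular \<nu> p h < \<infinity>"
    unfolding Lp_modular_\<nu>[OF True] by (subst integrable_iff_bounded) auto
  then show ?thesis by (simp add: Lp_space_def True)
qed (simp add: Lp_space_def)

lemma Lp_norm_less_iff:
  assumes h: "h \<in> Lp_space M p \<omega>" and "0 < \<epsilon>"
  shows "Lp_norm M p \<omega> h < \<epsilon> \<longleftrightarrow> Lp_modular \<nu> p h < ennreal (\<epsilon> powr p)"
proof -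
  define I where "I = (\<integral>t. (norm (h t) * \<omega> t) powr p \<partial>M)"
  have "0 \<le> I" unfolding I_def by (intro integral_nonneg_AE) auto
  have "h \<in> borel_measurable M" "integrable M (\<lambda>t. (norm (h t) * \<omega> t) powr p)"
    using h by (auto simp: Lp_space_def)
  then have modular: "Lp_modular \<nu> p h = ennreal I"
    unfolding I_def by (simp add: Lp_modular_\<nu> nn_integral_eq_integral)
  have "I powr (1 / p) < \<epsilon> \<longleftrightarrow> I < \<epsilon> powr p"
  proof
    assume "I powr (1 / p) < \<epsilon>"
    then have "(I powr (1 / p)) powr p < \<epsilon> powr p" using p_pos by (intro powr_less_mono2) auto
    then show "I < \<epsilon> powr p" using \<open>0 \<le> I\<close> p_pos by (simp add: powr_powr)
  next
    assume "I < \<epsilon> powr p"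
    then have "I powr (1 / p) < (\<epsilon> powr p) powr (1 / p)" using \<open>0 \<le> I\<close> p_pos by (intro powr_less_mono2) auto
    then show "I powr (1 / p) < \<epsilon>" using \<open>0 < \<epsilon>\<close> p_pos by (simp add: powr_powr)
  qed
  then show ?thesis using \<open>0 \<le> I\<close> by (simp add: modular Lp_norm_def I_def[symmetric] ennreal_less_iff)
qed

lemma Lp_space_diff:
  assumes "f \<in> Lp_space M p \<omega>" "g \<in> Lp_space M p \<omega>"
  shows "(\<lambda>t. f t - g t) \<in> Lp_space M p \<omega>"
proof -
  have m: "f \<in> borel_measurable \<nu>" "(\<lambda>t. - g t) \<in> borel_measurable \<nu>"
    using assms unfolding measurable_\<nu> Lp_space_iff by auto
  have "Lp_modular \<nu> p (\<lambda>t. f t + - g t) \<le> ennreal (2 powr p) * (Lp_modular \<nu> p f + Lp_modular \<nu> p (\<lambda>t. - g t))"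
    by (rule Lp_modular_add_le[OF m p_nonneg])
  also have "Lp_modular \<nu> p (\<lambda>t. - g t) = Lp_modular \<nu> p g" by (simp add: Lp_modular_def)
  also have "ennreal (2 powr p) * (Lp_modular \<nu> p f + Lp_modular \<nu> p g) < \<infinity>"
    using assms by (simp add: Lp_space_iff ennreal_mult_less_top)
  finally have "Lp_modular \<nu> p (\<lambda>t. f t - g t) < \<infinity>" by simp
  moreover have "(\<lambda>t. f t - g t) \<in> borel_measurable M"
    using assms unfolding Lp_space_iff by (intro borel_measurable_diff) auto
  ultimately show ?thesis by (simp only: Lp_space_iff)
qed

text \<open>
  The condition of the theorem for one sequence of compact sets and tolerances. Index 0 is reserved
  for the identity, with an empty set attached to it: the terms \<open>n = 0\<close> of the double sum then
  measure the sets \<open>- s k + K k\<close> themselves, while the terms \<open>k = 0\<close> vanish.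
\<close>

definition disperses :: "'g set \<Rightarrow> (nat \<Rightarrow> 'g set) \<Rightarrow> (nat \<Rightarrow> real) \<Rightarrow> bool" where
  "disperses S F \<delta> \<longleftrightarrow> (\<exists>(s :: nat \<Rightarrow> 'g) (K :: nat \<Rightarrow> 'g set).
          s 0 = 0 \<and> K 0 = {} \<and>
          (\<forall>n\<ge>1. s n \<in> S \<and> compact (K n) \<and> K n \<subseteq> F n \<and>
                  emeasure \<mu> (F n - K n) < ennreal (\<delta> n)) \<and>
          disjoint_family_on (\<lambda>n. (\<lambda>x. - s n + x) ` F n) {1..} \<and>
          (\<Sum>\<^sub>\<infinity>(n, k)\<in>{(n, k). n \<noteq> k}.
             \<integral>\<^sup>+t\<in>(\<lambda>x. s n + - s k + x) ` K k. ennreal (\<omega> t powr p) \<partial>completion \<mu>) < \<infinity>)"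

lemma countable_dense_compact_support:
  obtains D where "countable D" "D \<noteq> {}"
    "\<And>d. d \<in> D \<Longrightarrow> d \<in> borel_measurable borel"
    "\<And>d. d \<in> D \<Longrightarrow> \<exists>C M. compact C \<and> 0 \<le> M \<and> (\<forall>t. norm (d t) \<le> M * indicator C t)"
    "\<And>g \<epsilon>. g \<in> Lp_space M p \<omega> \<Longrightarrow> 0 < \<epsilon> \<Longrightarrow> \<exists>d\<in>D. Lp_modular \<nu> p (\<lambda>t. g t - d t) < ennreal \<epsilon>"
proof -
  have ae: "\<exists>B\<in>sets borel. AE t in \<nu>. t \<in> A \<longleftrightarrow> t \<in> B" if "A \<in> sets \<nu>" for A
  proof (rule bexI)
    have A: "A \<in> sets M" using that by (simp add: sets_\<nu>)
    have "AE t in \<mu>. t \<in> A \<longleftrightarrow> t \<in> main_part \<mu> A"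
      using AE_in_main_part[OF A] by eventually_elim simp
    then have "AE t in M. t \<in> A \<longleftrightarrow> t \<in> main_part \<mu> A" by (rule AE_completion)
    then show "AE t in \<nu>. t \<in> A \<longleftrightarrow> t \<in> main_part \<mu> A"
      by (rule absolutely_continuous_AE[OF sets_\<nu> ac_M_\<nu>])
    show "main_part \<mu> A \<in> sets borel" using main_part_sets[OF A] sets_\<mu> by simp
  qed
  have borel: "sets borel \<subseteq> sets \<nu>" using borel_in_M sets_\<nu> by auto
  show thesis
  proof (rule countable_dense_family[OF locally_compact p_pos borel ae emeasure_\<nu>_compact])
    fix D assume D: "countable D" "D \<noteq> {}"
      "\<And>d. d \<in> D \<Longrightarrow> d \<in> borel_measurable borel"
      "\<And>d. d \<in> D \<Longrightarrow> \<exists>C M. compact C \<and> 0 \<le> M \<and> (\<forall>t. norm (d t) \<le> M * indicator C t)"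
      "\<And>f. f \<in> borel_measurable \<nu> \<Longrightarrow> Lp_modular \<nu> p f < \<infinity> \<Longrightarrow> f \<in> Lp_closure \<nu> p D"
    show thesis
    proof (rule that[OF D(1-4)])
    fix g and \<epsilon> :: real assume "g \<in> Lp_space M p \<omega>" "0 < \<epsilon>"
    then show "\<exists>d\<in>D. Lp_modular \<nu> p (\<lambda>t. g t - d t) < ennreal \<epsilon>"
      using D(5)[of g] by (simp add: Lp_space_iff measurable_\<nu> Lp_closure_def)
    qed
  qed
qed

text \<open>
  Invariance of the completed measure, in the form of an inequality: \<open>Y\<close> is replaced by a Borel superset
  of equal measure, so that invariance on Borel sets applies.
\<close>

lemma emeasure_le_of_translate:
  assumes "X \<in> sets M" "Y \<in> sets M" and sub: "X \<subseteq> (\<lambda>x. s + x) ` Y"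
  shows "emeasure M X \<le> emeasure M Y"
proof -
  obtain Y' where Y': "Y \<subseteq> Y'" "Y' \<in> sets \<mu>" "emeasure M Y = emeasure \<mu> Y'"
    by (rule completion_upper[OF assms(2)])
  have Y'_borel: "Y' \<in> sets borel" using Y'(2) sets_\<mu> by simp
  have "(\<lambda>x. s + x) ` Y' \<in> sets borel"
    unfolding translation_image_eq_vimage
    using measurable_sets[OF borel_measurable_translation Y'_borel] by simp
  note image = this
  have "emeasure M X \<le> emeasure M ((\<lambda>x. s + x) ` Y')"
    using sub Y'(1) by (intro emeasure_mono borel_in_M image) blast
  also have "\<dots> = emeasure \<mu> ((\<lambda>x. s + x) ` Y')" by (rule emeasure_M_borel[OF image])
  also have "\<dots> = emeasure \<mu> Y'" by (rule translation_invariant[OF Y'_borel])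
  finally show ?thesis unfolding Y'(3) .
qed

lemma level_set_small:
  fixes f :: "'g \<Rightarrow> complex"
  assumes [measurable]: "f \<in> borel_measurable M" and C: "compact C" and "0 < \<delta>"
  obtains n :: nat where "1 \<le> n" "emeasure M {t\<in>C. real n \<le> norm (f t)} < ennreal \<delta>"
proof -
  have [measurable]: "C \<in> sets M" using C by (rule compact_in_M)
  define A where "A n = {t\<in>C. real n \<le> norm (f t)}" for n :: nat
  have A_eq: "A n = C \<inter> {t \<in> space M. real n \<le> norm (f t)}" for n
    by (auto simp: A_def space_\<mu>)
  have Am: "A n \<in> sets M" for n unfolding A_eq by measurable
  have "(\<lambda>n. emeasure M (A n)) \<longlonglongrightarrow> emeasure M (\<Inter>n. A n)"
  proof (rule Lim_emeasure_decseq)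
    show "range A \<subseteq> sets M" using Am by auto
    show "decseq A" by (intro decseq_SucI) (auto simp: A_def)
    have "emeasure M (A n) \<le> emeasure M C" for n by (intro emeasure_mono) (auto simp: A_def)
    moreover have "emeasure M C < \<infinity>"
      using C by (rule emeasure_M_compact)
    ultimately have "emeasure M (A n) < \<infinity>" for n by (rule le_less_trans)
    then show "emeasure M (A n) \<noteq> \<infinity>" for n by (rule less_imp_neq)
  qed
  moreover have "(\<Inter>n. A n) = {}"
  proof -
    have "\<exists>n. t \<notin> A n" for t
      using reals_Archimedean2[of "norm (f t)"] by (auto simp: A_def not_le)
    then show ?thesis by blast
  qed
  ultimately have "(\<lambda>n. emeasure M (A n)) \<longlonglongrightarrow> 0" by (simp only: emeasure_empty)
  then have "\<forall>\<^sub>F n in sequentially. emeasure M (A n) < ennreal \<delta>"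
    using \<open>0 < \<delta>\<close> by (intro order_tendstoD(2)) auto
  then obtain n where "\<And>m. n \<le> m \<Longrightarrow> emeasure M (A m) < ennreal \<delta>"
    by (auto simp: eventually_sequentially)
  from this[of "max 1 n"] show thesis unfolding A_def by (intro that[of "max 1 n"]) auto
qed

end

section \<open>A dense vector yields nearly disjoint translates\<close>

lemma infsum_pairs_le:
  fixes a :: "nat \<Rightarrow> nat \<Rightarrow> ennreal"
  assumes row: "\<And>n I. finite I \<Longrightarrow> n \<notin> I \<Longrightarrow> (\<Sum>k\<in>I. a n k) \<le> b n"
    and total: "\<And>A. finite A \<Longrightarrow> (\<Sum>n\<in>A. b n) \<le> B"
  shows "(\<Sum>\<^sub>\<infinity>(n, k)\<in>{(n, k). n \<noteq> k}. a n k) \<le> B"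
proof (rule infsum_le_finite_sums)
  fix \<Phi> :: "(nat \<times> nat) set" assume \<Phi>: "finite \<Phi>" "\<Phi> \<subseteq> {(n, k). n \<noteq> k}"
  have "(\<Sum>(n, k)\<in>\<Phi>. a n k) \<le> (\<Sum>(n, k)\<in>(SIGMA n:fst ` \<Phi>. snd ` \<Phi> - {n}). a n k)"
    using \<Phi> by (intro sum_mono2) (force intro: finite_SigmaI)+
  also have "\<dots> = (\<Sum>n\<in>fst ` \<Phi>. \<Sum>k\<in>snd ` \<Phi> - {n}. a n k)"
    using \<Phi>(1) by (intro sum.Sigma[symmetric]) auto
  also have "\<dots> \<le> (\<Sum>n\<in>fst ` \<Phi>. b n)"
    using \<Phi>(1) by (intro sum_mono row) auto
  also have "\<dots> \<le> B" using \<Phi>(1) by (intro total) auto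
  finally show "(\<Sum>(n, k)\<in>\<Phi>. a n k) \<le> B" .
next
  show "(\<lambda>(n, k). a n k) summable_on {(n, k). n \<noteq> k}"
    by (rule nonneg_summable_on_complete) simp
qed

text \<open>A Chebyshev inequality, summed over disjoint sets: this is how the rows of the double sum are bounded.\<close>

lemma sum_emeasure_le_Lp_modular:
  assumes "finite I" and R: "\<And>k. k \<in> I \<Longrightarrow> R k \<in> sets N" "disjoint_family_on R I"
    and h: "\<And>k t. k \<in> I \<Longrightarrow> t \<in> R k \<Longrightarrow> 1 \<le> norm (h t)" and "0 \<le> p"
  shows "(\<Sum>k\<in>I. emeasure N (R k)) \<le> Lp_modular N p h"
proof -
  have "(\<Sum>k\<in>I. emeasure N (R k)) = emeasure N (\<Union>k\<in>I. R k)"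
    using assms by (intro sum_emeasure) auto
  also have "\<dots> = (\<integral>\<^sup>+t. indicator (\<Union>k\<in>I. R k) t \<partial>N)"
    using R(1) \<open>finite I\<close> by (intro nn_integral_indicator[symmetric] sets.finite_UN) auto
  also have "\<dots> \<le> Lp_modular N p h"
    unfolding Lp_modular_def
  proof (rule nn_integral_mono)
    fix t
    show "indicator (\<Union>k\<in>I. R k) t \<le> ennreal (norm (h t) powr p)"
      using h[of _ t] \<open>0 \<le> p\<close> ge_one_powr_ge_zero[of "norm (h t)" p]
      by (auto simp: indicator_def)
  qed
  finally show ?thesis .
qed

context weighted_haar
begin

text \<open>
  The target is \<open>c = 2 n\<close> times the indicator of \<open>F\<close>, with \<open>n\<close> so large that \<open>|f| \<ge> n\<close> holds only on a
  small part of the compact set \<open>- C + F\<close>. A translate of \<open>f\<close> close to the target has modulus at least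
  \<open>n\<close> on most of \<open>F\<close>. For \<open>s \<in> C\<close> this would carry most of \<open>F\<close> into the small set just mentioned, which
  is impossible as \<open>F\<close> has positive measure.
\<close>

lemma dense_vector_approximates_outside_compact:
  assumes dense: "dense_vector M p S \<omega> f"
    and F: "compact F" "0 < emeasure \<mu> F" and C: "compact C"
    and \<delta>: "0 < \<delta>" and \<eta>: "0 < \<eta>"
  obtains s K c where "s \<in> S" "s \<notin> C" "compact K" "K \<subseteq> F" "emeasure \<mu> (F - K) < ennreal \<delta>"
    "\<And>t. t \<in> K \<Longrightarrow> 1 \<le> norm (f (- s + t))"
    "Lp_modular \<nu> p (\<lambda>t. f (- s + t) - c * indicator F t) < ennreal \<eta>"
proof -
  have f: "f \<in> borel_measurable M" using dense by (simp add: dense_vector_def Lp_space_def)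
  have F_M: "F \<in> sets M" using F(1) by (rule compact_in_M)
  have F_fin: "emeasure M F < \<infinity>" using F(1) by (rule emeasure_M_compact)
  have F_pos: "0 < emeasure M F" using F emeasure_M_borel[OF borel_compact[OF F(1)]] by simp
  obtain m where m: "emeasure M F = ennreal m" "0 < m"
    using F_fin F_pos by (cases "emeasure M F") (auto simp: ennreal_less_zero_iff)
  (* F is split into two parts of measure below \<delta>'; any bound under half the measure of F will do. *)
  define \<delta>' where "\<delta>' = min \<delta> (m / 3)"
  have \<delta>': "0 < \<delta>'" "\<delta>' \<le> \<delta>" "\<delta>' + \<delta>' < m" using \<delta> m by (auto simp: \<delta>'_def)
  define C' where "C' = (\<lambda>(s, x). - s + x) ` (C \<times> F)"
  have "compact C'"
    unfolding C'_def case_prod_unfold using F(1) C by (intro compact_continuous_image compact_Times continuous_intros) auto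
  then obtain n :: nat where n: "1 \<le> n" "emeasure M {u\<in>C'. real n \<le> norm (f u)} < ennreal \<delta>'"
    using level_set_small[OF f _ \<delta>'(1)] by metis
  obtain \<eta>' where \<eta>': "0 < \<eta>'"
    "\<And>A. A \<in> sets M \<Longrightarrow> A \<subseteq> F \<Longrightarrow> emeasure \<nu> A < ennreal \<eta>' \<Longrightarrow> emeasure M A < ennreal \<delta>'"
    using absolutely_continuous_epsilon_delta[OF ac_\<nu>_M sets_\<nu>[symmetric] _ F_fin \<delta>'(1)] F_M sets_\<nu> by metis
  define c :: complex where "c = of_nat (2 * n)"
  define g where "g = (\<lambda>t. c * indicator F t)"
  have "g \<in> Lp_space M p \<omega>"
  proof -
    have "g \<in> borel_measurable M" unfolding g_def using F_M by measurable
    moreover have "Lp_modular \<nu> p g < \<infinity>"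
      unfolding g_def using F_M p_pos emeasure_\<nu>_compact[OF F(1)]
      by (subst Lp_modular_mult_indicator) (auto simp: sets_\<nu> ennreal_mult_less_top)
    ultimately show ?thesis unfolding Lp_space_iff by simp
  qed
  have "0 < min \<eta> \<eta>' powr (1 / p)" using \<eta> \<eta>'(1) by simp
  with dense \<open>g \<in> Lp_space M p \<omega>\<close> obtain s where s: "s \<in> S"
    "Lp_norm M p \<omega> (\<lambda>t. translate s f t - g t) < min \<eta> \<eta>' powr (1 / p)"
    unfolding dense_vector_def by meson
  have Ts: "translate s f \<in> Lp_space M p \<omega>" using dense s(1) by (simp add: dense_vector_def)
  have "Lp_modular \<nu> p (\<lambda>t. translate s f t - g t) < ennreal ((min \<eta> \<eta>' powr (1 / p)) powr p)"
    using s(2) Lp_norm_less_iff[OF Lp_space_diff[OF Ts \<open>g \<in> _\<close>] \<open>0 < min \<eta> \<eta>' powr (1 / p)\<close>] by blast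
  also have "(min \<eta> \<eta>' powr (1 / p)) powr p = min \<eta> \<eta>'"
    using \<eta> \<eta>'(1) p_pos by (simp add: powr_powr)
  finally have modular: "Lp_modular \<nu> p (\<lambda>t. f (- s + t) - c * indicator F t) < ennreal (min \<eta> \<eta>')"
    by (simp only: translate_def g_def)
  define E where "E = {t. real n \<le> norm (f (- s + t))}"
  have E: "E \<in> sets M"
  proof -
    have [measurable]: "(\<lambda>t. f (- s + t)) \<in> borel_measurable M"
      using Ts by (simp add: Lp_space_def translate_def)
    have "{t \<in> space M. real n \<le> norm (f (- s + t))} \<in> sets M" by measurable
    then show ?thesis by (simp add: E_def space_\<mu>)
  qed
  have "emeasure \<nu> (F - E) \<le> Lp_modular \<nu> p (\<lambda>t. f (- s + t) - c * indicator F t)"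
  proof -
    have "1 \<le> norm (f (- s + t) - c * indicator F t)" if "t \<in> F - E" for t
    proof -
      have "norm (f (- s + t)) < n" "norm c = 2 * n" "indicator F t = (1::complex)"
        using that by (auto simp: E_def c_def)
      then show ?thesis using norm_triangle_ineq3[of "f (- s + t)" c] n(1) by simp
    qed
    then show ?thesis
      using sum_emeasure_le_Lp_modular[of "{()}" "\<lambda>_. F - E" \<nu> "\<lambda>t. f (- s + t) - c * indicator F t" p]
        p_nonneg F_M E by (simp add: sets_\<nu> sets.Diff disjoint_family_on_def)
  qed
  also have "\<dots> < ennreal \<eta>'" using modular by (rule less_le_trans) (simp add: ennreal_leI)
  finally have small: "emeasure M (F - E) < ennreal \<delta>'"
    using \<eta>'(2)[of "F - E"] F_M E by blast
  have "s \<notin> C"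
  proof
    assume "s \<in> C"
    have level: "{u\<in>C'. real n \<le> norm (f u)} \<in> sets M"
    proof -
      have [measurable]: "C' \<in> sets M" using \<open>compact C'\<close> by (rule compact_in_M)
      note f[measurable]
      have "C' \<inter> {u \<in> space M. real n \<le> norm (f u)} \<in> sets M" by measurable
      moreover have "C' \<inter> {u \<in> space M. real n \<le> norm (f u)} = {u\<in>C'. real n \<le> norm (f u)}"
        by (auto simp: space_\<mu>)
      ultimately show ?thesis by metis
    qed
    have "F \<inter> E \<subseteq> (\<lambda>x. s + x) ` {u\<in>C'. real n \<le> norm (f u)}"
    proof
      fix t assume "t \<in> F \<inter> E"
      then have "- s + t \<in> {u\<in>C'. real n \<le> norm (f u)}"
        using \<open>s \<in> C\<close> by (auto simp: C'_def E_def)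
      moreover have "t = s + (- s + t)" by (simp add: add.assoc[symmetric])
      ultimately show "t \<in> (\<lambda>x. s + x) ` {u\<in>C'. real n \<le> norm (f u)}" by (rule rev_image_eqI)
    qed
    then have "emeasure M (F \<inter> E) \<le> emeasure M {u\<in>C'. real n \<le> norm (f u)}"
      by (rule emeasure_le_of_translate[OF sets.Int[OF F_M E] level])
    also have "\<dots> < ennreal \<delta>'" by (rule n(2))
    finally have "emeasure M (F \<inter> E) + emeasure M (F - E) < ennreal \<delta>' + ennreal \<delta>'"
      using small by (rule add_strict_mono)
    also have "ennreal \<delta>' + ennreal \<delta>' = ennreal (\<delta>' + \<delta>')" using \<delta>'(1) by (intro ennreal_plus[symmetric]) auto
    also have "emeasure M (F \<inter> E) + emeasure M (F - E) = emeasure M ((F \<inter> E) \<union> (F - E))"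
      using F_M E by (intro plus_emeasure) auto
    also have "(F \<inter> E) \<union> (F - E) = F" by blast
    finally show False using m \<delta>' by (simp only: m(1)) (simp add: ennreal_less_iff)
  qed
  have outer: "emeasure \<mu> A = (INF U\<in>{U. open U \<and> A \<subseteq> U}. emeasure \<mu> U)" if "A \<in> sets borel" for A
    using haar that by (simp add: left_haar_measure_def)
  obtain K where K: "compact K" "K \<subseteq> F" "K \<subseteq> E" "emeasure \<mu> (F - K) < ennreal \<delta>'"
    by (rule compact_inner_approximation[OF sets_\<mu> outer F(1) E small])
  show thesis
  proof (rule that[OF s(1) \<open>s \<notin> C\<close> K(1,2)])
    show "emeasure \<mu> (F - K) < ennreal \<delta>"
      using K(4) \<delta>'(2) by (auto intro: less_le_trans simp: ennreal_leI)
    show "1 \<le> norm (f (- s + t))" if "t \<in> K" for t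
    proof -
      have "real n \<le> norm (f (- s + t))" using that K(3) by (auto simp: E_def)
      then show ?thesis using n(1) by linarith
    qed
    show "Lp_modular \<nu> p (\<lambda>t. f (- s + t) - c * indicator F t) < ennreal \<eta>"
      using modular by (rule less_le_trans) (simp add: ennreal_leI)
  qed
qed

lemma exists_compact_positive:
  obtains V where "compact V" "0 < emeasure \<mu> V"
proof -
  obtain L :: "nat \<Rightarrow> 'g set" where L: "\<And>n. compact (L n)" "(\<Union>n. L n) = UNIV"
    using countable_compact_cover[OF locally_compact] by metis
  have "\<exists>n. emeasure \<mu> (L n) \<noteq> 0"
  proof (rule ccontr)
    assume "\<nexists>n. emeasure \<mu> (L n) \<noteq> 0"
    then have "L n \<in> null_sets \<mu>" for n using L(1) sets_\<mu> by (auto simp: null_sets_def borel_compact)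
    then have "(\<Union>n. L n) \<in> null_sets \<mu>" by (intro null_sets_UN)
    then show False using haar L(2) by (auto simp: null_sets_def left_haar_measure_def)
  qed
  then show thesis using that L(1) by (auto simp: zero_less_iff_neq_zero)
qed

lemma necessity:
  fixes F :: "nat \<Rightarrow> 'g set" and \<delta> :: "nat \<Rightarrow> real"
  assumes dense: "dense_vector M p S \<omega> f"
    and F: "\<And>n. 1 \<le> n \<Longrightarrow> compact (F n)" and \<delta>: "\<And>n. 1 \<le> n \<Longrightarrow> 0 < \<delta> n"
  shows "disperses S F \<delta>"
proof -
  obtain V where V: "compact V" "0 < emeasure \<mu> V" by (rule exists_compact_positive)
  (* The sets F n may be null, but escaping from compact sets requires positive measure.
     Index 0 gets harmless values, so that the construction can run over all natural numbers. *)
  define F' where "F' n = (if n = 0 then V else F n \<union> V)" for n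
  define \<delta>' where "\<delta>' n = (if n = 0 then 1 else \<delta> n)" for n
  have F': "compact (F' n)" for n using F V by (simp add: F'_def compact_Un)
  have F'_pos: "0 < emeasure \<mu> (F' n)" for n
  proof -
    have "emeasure \<mu> V \<le> emeasure \<mu> (F' n)"
      using F'[of n] sets_\<mu> by (intro emeasure_mono) (auto simp: F'_def borel_compact)
    then show ?thesis using V(2) by (rule less_le_trans[rotated])
  qed
  define Q where "Q n s K c \<longleftrightarrow> s \<in> S \<and> compact K \<and> K \<subseteq> F' n \<and> emeasure \<mu> (F' n - K) < ennreal (\<delta>' n) \<and>
      (\<forall>t\<in>K. 1 \<le> norm (f (- s + t))) \<and>
      Lp_modular \<nu> p (\<lambda>t. f (- s + t) - c * indicator (F' n) t) < ennreal ((1/2) ^ n)" for n s K c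
  have "\<exists>s. s \<notin> C \<and> (\<exists>K c. Q n s K c)" if C: "compact C" for n C
  proof -
    have "0 < \<delta>' n" "0 < (1/2 :: real) ^ n" using \<delta> by (auto simp: \<delta>'_def)
    from dense_vector_approximates_outside_compact[OF dense F' F'_pos C this, of n]
    obtain s K c where "s \<in> S" "s \<notin> C" "compact K" "K \<subseteq> F' n" "emeasure \<mu> (F' n - K) < ennreal (\<delta>' n)"
      "\<And>t. t \<in> K \<Longrightarrow> 1 \<le> norm (f (- s + t))"
      "Lp_modular \<nu> p (\<lambda>t. f (- s + t) - c * indicator (F' n) t) < ennreal ((1/2) ^ n)"
      by blast
    then show ?thesis unfolding Q_def by blast
  qed
  from disjoint_translates_choice[of F' "\<lambda>n s. \<exists>K c. Q n s K c", OF F' this]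
  obtain \<sigma> where \<sigma>: "\<And>n. \<exists>K c. Q n (\<sigma> n) K c" "disjoint_family (\<lambda>n. (\<lambda>x. - \<sigma> n + x) ` F' n)"
    by blast
  obtain K' c where Q: "\<And>n. Q n (\<sigma> n) (K' n) (c n)" using \<sigma>(1) by metis
  define s where "s n = (if n = 0 then 0 else \<sigma> n)" for n
  define K where "K n = (if n = 0 then {} else K' n \<inter> F n)" for n
  have KF': "K n \<subseteq> F' n" "K n \<subseteq> K' n" for n by (auto simp: K_def F'_def)
  have compK: "compact (K n)" for n
    using Q[of n] F[of n] by (auto simp: K_def Q_def intro: compact_Int)
  define R where "R u k = (\<lambda>x. u + - s k + x) ` K k" for u k
  have R_M: "R u k \<in> sets M" for u k
    unfolding R_def by (intro compact_in_M compact_translation_image compK)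
  have sub: "R u k \<subseteq> (\<lambda>x. u + x) ` ((\<lambda>x. - \<sigma> k + x) ` F' k)" for u k
  proof
    fix t assume "t \<in> R u k"
    then obtain x where x: "x \<in> K k" "t = u + - s k + x" by (auto simp: R_def)
    then have "t = u + (- \<sigma> k + x)" "x \<in> F' k"
      using KF'(1)[of k] by (auto simp: K_def s_def add.assoc[symmetric] split: if_splits)
    then show "t \<in> (\<lambda>x. u + x) ` ((\<lambda>x. - \<sigma> k + x) ` F' k)" by blast
  qed
  have disj: "disjoint_family (R u)" for u
    unfolding disjoint_family_on_def
  proof (intro ballI impI)
    fix k l :: nat assume "k \<noteq> l"
    then have "(\<lambda>x. - \<sigma> k + x) ` F' k \<inter> (\<lambda>x. - \<sigma> l + x) ` F' l = {}"
      using \<sigma>(2) by (auto simp: disjoint_family_on_def)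
    then have "(\<lambda>x. u + x) ` ((\<lambda>x. - \<sigma> k + x) ` F' k) \<inter> (\<lambda>x. u + x) ` ((\<lambda>x. - \<sigma> l + x) ` F' l) = {}"
      by (subst image_Int[symmetric]) (auto simp: inj_on_def)
    then show "R u k \<inter> R u l = {}" using sub[of u k] sub[of u l] by blast
  qed
  have large: "1 \<le> norm (f (- u + t))" if t: "t \<in> R u k" for u t k
  proof -
    obtain x where x: "x \<in> K k" "t = u + - s k + x" using t by (auto simp: R_def)
    then have "k \<noteq> 0" by (auto simp: K_def split: if_splits)
    then have "- u + t = - \<sigma> k + x" using x(2) by (simp add: s_def add.assoc del: add_uminus_conv_diff)
    moreover have "x \<in> K' k" using x(1) KF'(2) by blast
    ultimately show ?thesis using Q[of k] by (auto simp: Q_def)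
  qed
  define b where "b n = (if n = 0 then Lp_modular \<nu> p f else 0) + ennreal ((1/2) ^ n)" for n :: nat
  have row: "(\<Sum>k\<in>I. emeasure \<nu> (R (s n) k)) \<le> b n" if I: "finite I" "n \<notin> I" for n I
  proof (cases "n = 0")
    case True
    have "(\<Sum>k\<in>I. emeasure \<nu> (R (s n) k)) \<le> Lp_modular \<nu> p f"
    proof (rule sum_emeasure_le_Lp_modular[OF I(1) _ _ _ p_nonneg])
      show "R (s n) k \<in> sets \<nu>" for k using R_M by (simp only: sets_\<nu>)
      show "disjoint_family_on (R (s n)) I" using disj by (rule disjoint_family_on_mono[rotated]) simp
      show "1 \<le> norm (f t)" if "t \<in> R (s n) k" for k t
        using large[OF that] True by (simp add: s_def)
    qed
    also have "\<dots> \<le> b n" using True by (simp add: b_def)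
    finally show ?thesis .
  next
    case False
    have "(\<Sum>k\<in>I. emeasure \<nu> (R (s n) k)) \<le> Lp_modular \<nu> p (\<lambda>t. f (- \<sigma> n + t) - c n * indicator (F' n) t)"
    proof (rule sum_emeasure_le_Lp_modular[OF I(1) _ _ _ p_nonneg])
      show "R (s n) k \<in> sets \<nu>" for k using R_M by (simp only: sets_\<nu>)
      show "disjoint_family_on (R (s n)) I" using disj by (rule disjoint_family_on_mono[rotated]) simp
      fix k t assume k: "k \<in> I" and t: "t \<in> R (s n) k"
      have sn: "s n = \<sigma> n" using False by (simp add: s_def)
      have "t \<notin> F' n"
      proof
        assume "t \<in> F' n"
        then have "- \<sigma> n + t \<in> (\<lambda>x. - \<sigma> n + x) ` F' n" by blast
        moreover have "- \<sigma> n + t \<in> (\<lambda>x. - \<sigma> k + x) ` F' k"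
        proof -
          obtain y where "y \<in> (\<lambda>x. - \<sigma> k + x) ` F' k" "t = \<sigma> n + y"
            using t sub[of "s n" k] unfolding sn by blast
          then show ?thesis by simp
        qed
        moreover have "k \<noteq> n" using k I(2) by blast
        ultimately show False using \<sigma>(2) by (auto simp: disjoint_family_on_def)
      qed
      then show "1 \<le> norm (f (- \<sigma> n + t) - c n * indicator (F' n) t)"
        using large[OF t] by (simp add: sn)
    qed
    also have "\<dots> \<le> ennreal ((1/2) ^ n)" using Q[of n] unfolding Q_def by (blast intro: less_imp_le)
    also have "\<dots> \<le> b n" by (simp add: b_def)
    finally show ?thesis .
  qed
  have total: "(\<Sum>n\<in>A. b n) \<le> Lp_modular \<nu> p f + ennreal 2" if "finite A" for A
  proof -
    have "(\<Sum>n\<in>A. b n) = (\<Sum>n\<in>A. if n = 0 then Lp_modular \<nu> p f else 0) + (\<Sum>n\<in>A. ennreal ((1/2) ^ n))"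
      unfolding b_def by (rule sum.distrib)
    also have "\<dots> \<le> Lp_modular \<nu> p f + ennreal 2"
    proof (rule add_mono)
      show "(\<Sum>n\<in>A. if n = 0 then Lp_modular \<nu> p f else 0) \<le> Lp_modular \<nu> p f"
        using \<open>finite A\<close> by simp
      have "(\<Sum>n\<in>A. (1/2 :: real) ^ n) \<le> (\<Sum>n. (1/2) ^ n)"
        using \<open>finite A\<close> by (intro sum_le_suminf summable_geometric) auto
      also have "\<dots> = 2" by (subst suminf_geometric) auto
      finally have "ennreal (\<Sum>n\<in>A. (1/2) ^ n) \<le> ennreal 2" by (rule ennreal_leI)
      moreover have "(\<Sum>n\<in>A. ennreal ((1/2) ^ n)) = ennreal (\<Sum>n\<in>A. (1/2) ^ n)"
        by (rule sum_ennreal) simp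
      ultimately show "(\<Sum>n\<in>A. ennreal ((1/2) ^ n)) \<le> ennreal 2" by (simp only:)
    qed
    finally show ?thesis .
  qed
  have sum: "(\<Sum>\<^sub>\<infinity>(n, k)\<in>{(n, k). n \<noteq> k}. emeasure \<nu> (R (s n) k)) < \<infinity>"
  proof (rule le_less_trans[OF infsum_pairs_le[OF row total]])
    show "Lp_modular \<nu> p f + ennreal 2 < \<infinity>"
      using dense by (simp add: dense_vector_def Lp_space_iff)
  qed
  have "\<forall>n\<ge>1. s n \<in> S \<and> compact (K n) \<and> K n \<subseteq> F n \<and> emeasure \<mu> (F n - K n) < ennreal (\<delta> n)"
  proof (intro allI impI conjI)
    fix n :: nat assume n: "1 \<le> n"
    show "s n \<in> S" using Q[of n] n by (simp add: Q_def s_def)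
    show "compact (K n)" by (rule compK)
    show "K n \<subseteq> F n" using n by (auto simp: K_def)
    have "F n - K n \<subseteq> F' n - K' n" using n by (auto simp: K_def F'_def)
    moreover have "F' n - K' n \<in> sets \<mu>"
      using F'[of n] Q[of n] by (auto simp: sets_\<mu> Q_def borel_compact)
    ultimately have "emeasure \<mu> (F n - K n) \<le> emeasure \<mu> (F' n - K' n)" by (rule emeasure_mono)
    also have "\<dots> < ennreal (\<delta> n)" using Q[of n] n by (simp add: Q_def \<delta>'_def)
    finally show "emeasure \<mu> (F n - K n) < ennreal (\<delta> n)" .
  qed
  moreover have "disjoint_family_on (\<lambda>n. (\<lambda>x. - s n + x) ` F n) {1..}"
    unfolding disjoint_family_on_def
  proof (intro ballI impI)
    fix m n :: nat assume mn: "m \<in> {1..}" "n \<in> {1..}" "m \<noteq> n"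
    have "(\<lambda>x. - s m + x) ` F m \<subseteq> (\<lambda>x. - \<sigma> m + x) ` F' m" "(\<lambda>x. - s n + x) ` F n \<subseteq> (\<lambda>x. - \<sigma> n + x) ` F' n"
      using mn by (auto simp: s_def F'_def)
    then show "(\<lambda>x. - s m + x) ` F m \<inter> (\<lambda>x. - s n + x) ` F n = {}"
      using disjoint_family_onD[OF \<sigma>(2), of m n] mn(3) by blast
  qed
  ultimately show ?thesis
    using sum unfolding disperses_def emeasure_\<nu>[OF R_M] unfolding R_def
    by (intro exI[of _ s] exI[of _ K]) (simp add: s_def K_def)
qed

end

section \<open>Nearly disjoint translates yield a dense vector\<close>

lemma ennreal_suminf_commute:
  fixes a :: "nat \<Rightarrow> nat \<Rightarrow> ennreal"
  shows "(\<Sum>i. \<Sum>j. a i j) = (\<Sum>j. \<Sum>i. a i j)"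
proof -
  have "(\<Sum>i. \<Sum>j. a i j) = (\<integral>\<^sup>+i. (\<Sum>j. a i j) \<partial>count_space UNIV)"
    by (rule nn_integral_count_space_nat[symmetric])
  also have "\<dots> = (\<Sum>j. \<integral>\<^sup>+i. a i j \<partial>count_space UNIV)"
    by (intro nn_integral_suminf) simp
  also have "\<dots> = (\<Sum>j. \<Sum>i. a i j)"
    by (simp only: nn_integral_count_space_nat)
  finally show ?thesis .
qed

lemma suminf_columns_le_infsum:
  fixes a :: "nat \<Rightarrow> nat \<Rightarrow> ennreal"
  shows "(\<Sum>k. \<Sum>n. if n = k then 0 else a n k) \<le> (\<Sum>\<^sub>\<infinity>(n, k)\<in>{(n, k). n \<noteq> k}. a n k)"
    (is "_ \<le> ?B")
proof (rule suminf_le_const[OF summableI])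
  define a' where "a' n k = (if n = k then 0 else a n k)" for n k
  fix N
  have "(\<Sum>k<N. \<Sum>n. a' n k) = (\<Sum>n. \<Sum>k<N. a' n k)"
    by (intro suminf_sum[symmetric] summableI)
  also have "\<dots> \<le> ?B"
  proof (rule suminf_le_const[OF summableI])
    fix m
    let ?\<Phi> = "{(n, k) \<in> {..<m} \<times> {..<N}. n \<noteq> k}"
    have fin: "finite ?\<Phi>" by (rule finite_subset[of _ "{..<m} \<times> {..<N}"]) auto
    have "(\<Sum>n<m. \<Sum>k<N. a' n k) = (\<Sum>(n, k)\<in>{..<m} \<times> {..<N}. a' n k)"
      by (simp add: sum.cartesian_product)
    also have "\<dots> = (\<Sum>(n, k)\<in>?\<Phi>. a n k)"
      by (intro sum.mono_neutral_cong_right) (auto simp: a'_def)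
    also have "\<dots> \<le> ?B"
    proof -
      have "?B = (SUP \<Phi>\<in>{\<Phi>. finite \<Phi> \<and> \<Phi> \<subseteq> {(n, k). n \<noteq> k}}. \<Sum>(n, k)\<in>\<Phi>. a n k)"
        by (rule nonneg_infsum_complete) simp
      then show ?thesis using fin by (simp only:) (intro SUP_upper, auto)
    qed
    finally show "(\<Sum>n<m. \<Sum>k<N. a' n k) \<le> ?B" .
  qed
  finally show "(\<Sum>k<N. \<Sum>n. if n = k then 0 else a n k) \<le> ?B" by (simp only: a'_def)
qed

lemma suminf_finite_tail_small:
  fixes A :: "nat \<Rightarrow> ennreal"
  assumes "(\<Sum>k. A k) < \<infinity>" and "0 < \<epsilon>"
  obtains N where "\<And>n. N \<le> n \<Longrightarrow> A n < ennreal \<epsilon>"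
proof -
  have fin: "A k < \<infinity>" for k
    using sum_le_suminf[of A "{k}"] assms(1) by (auto intro: le_less_trans)
  define x where "x k = enn2real (A k)" for k
  have x: "A k = ennreal (x k)" "0 \<le> x k" for k using fin[of k] by (auto simp: x_def)
  have "(\<Sum>k. ennreal (x k)) \<noteq> top" using assms(1) by (simp flip: x(1))
  then have "summable x" using x(2) by (rule summable_suminf_not_top[rotated])
  then have "x \<longlonglongrightarrow> 0" by (rule summable_LIMSEQ_zero)
  then have "\<forall>\<^sub>F n in sequentially. x n < \<epsilon>" using \<open>0 < \<epsilon>\<close> by (rule order_tendstoD(2))
  then obtain N where "\<And>n. N \<le> n \<Longrightarrow> x n < \<epsilon>" by (auto simp: eventually_sequentially)
  then show thesis using that[of N] x \<open>0 < \<epsilon>\<close> by (simp add: ennreal_less_iff)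
qed

lemma suminf_subsequence_le:
  fixes a :: "nat \<Rightarrow> ennreal"
  assumes "inj \<tau>"
  shows "(\<Sum>i. a (\<tau> i)) \<le> (\<Sum>n. a n)"
proof (rule suminf_le_const[OF summableI])
  fix m
  have "(\<Sum>i<m. a (\<tau> i)) = (\<Sum>n\<in>\<tau> ` {..<m}. a n)"
    using assms by (subst sum.reindex) (auto intro: inj_on_subset)
  also have "\<dots> \<le> (\<Sum>n. a n)" by (intro sum_le_suminf summableI) auto
  finally show "(\<Sum>i<m. a (\<tau> i)) \<le> (\<Sum>n. a n)" .
qed

lemma strict_mono_choice:
  assumes "\<And>j N :: nat. \<exists>n\<ge>N. P j n"
  obtains \<tau> :: "nat \<Rightarrow> nat" where "strict_mono \<tau>" "\<And>j. P j (\<tau> j)" "\<And>j. j < \<tau> j"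
proof -
  have "\<exists>\<tau>. \<forall>j. (P j (\<tau> j) \<and> j < \<tau> j) \<and> \<tau> j < \<tau> (Suc j)"
  proof (rule dependent_nat_choice)
    show "\<exists>n. P 0 n \<and> 0 < n" using assms[of 1 0] by (auto simp: Suc_le_eq)
    show "\<exists>m. (P (Suc j) m \<and> Suc j < m) \<and> n < m" for n j
      using assms[of "Suc (max n (Suc j))" "Suc j"] by (auto simp: Suc_le_eq)
  qed
  then obtain \<tau> where "\<And>j. P j (\<tau> j)" "\<And>j. j < \<tau> j" "\<And>j. \<tau> j < \<tau> (Suc j)" by blast
  then show thesis using that strict_mono_Suc_iff by blast
qed

text \<open>
  Removing one term from a series with at most one nonzero term. The disjoint supports make this hold
  pointwise for \<open>glue\<close>, where no convergence in norm is available.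
\<close>

lemma suminf_single_support:
  fixes h :: "nat \<Rightarrow> 'a::real_normed_vector"
  assumes "\<And>j k. h j \<noteq> 0 \<Longrightarrow> h k \<noteq> 0 \<Longrightarrow> j = k"
  shows "(\<Sum>j. h j) - h i = (\<Sum>j. if j = i then 0 else h j)"
proof -
  have "finite {j. h j \<noteq> 0}"
  proof (cases "\<exists>j. h j \<noteq> 0")
    case True
    then obtain j where "h j \<noteq> 0" by blast
    then have "{k. h k \<noteq> 0} \<subseteq> {j}" using assms by blast
    then show ?thesis by (rule finite_subset) simp
  qed simp
  then have "summable h" by (intro summable_finite[of "{j. h j \<noteq> 0}"]) auto
  then have "(\<lambda>j. h j - (if j = i then h j else 0)) sums ((\<Sum>j. h j) - h i)"
    by (intro sums_diff summable_sums sums_single)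
  moreover have "(\<lambda>j. h j - (if j = i then h j else 0)) = (\<lambda>j. if j = i then 0 else h j)" by auto
  ultimately show ?thesis by (metis sums_unique)
qed

text \<open>Each \<open>h j\<close> is moved back by \<open>\<sigma> j\<close>, so that translating the sum by \<open>\<sigma> j\<close> restores \<open>h j\<close>.\<close>

definition glue :: "(nat \<Rightarrow> 'g::group_add) \<Rightarrow> (nat \<Rightarrow> 'g \<Rightarrow> complex) \<Rightarrow> 'g \<Rightarrow> complex" where
  "glue \<sigma> h = (\<lambda>t. \<Sum>j. h j (\<sigma> j + t))"

context weighted_haar
begin

lemma glue_measurable:
  assumes "\<And>j. h j \<in> borel_measurable borel"
  shows "glue \<sigma> h \<in> borel_measurable (borel :: 'g measure)"
proof -
  have "(\<lambda>t. h j (\<sigma> j + t)) \<in> borel_measurable borel" for j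
    by (rule measurable_compose[OF borel_measurable_translation assms])
  then show ?thesis unfolding glue_def by (intro borel_measurable_suminf)
qed

lemma translate_support:
  fixes h :: "'g \<Rightarrow> complex"
  assumes "\<And>t. norm (h t) \<le> c * indicator K t"
  shows "norm (h (s + (- u + t))) \<le> c * indicator ((\<lambda>x. u + - s + x) ` K) t"
proof (cases "s + (- u + t) \<in> K")
  case True
  have "t = u + - s + (s + (- u + t))" by (simp add: add.assoc del: add_uminus_conv_diff)
  then have "t \<in> (\<lambda>x. u + - s + x) ` K" using True by blast
  then show ?thesis using assms[of "s + (- u + t)"] True by simp
next
  case False
  have "t \<notin> (\<lambda>x. u + - s + x) ` K"
  proof
    assume "t \<in> (\<lambda>x. u + - s + x) ` K"
    then obtain x where "x \<in> K" "t = u + - s + x" by blast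
    then have "s + (- u + t) = x" by (simp add: add.assoc del: add_uminus_conv_diff)
    then show False using False \<open>x \<in> K\<close> by simp
  qed
  then show ?thesis using assms[of "s + (- u + t)"] False by simp
qed

lemma disjoint_family_translate:
  fixes K :: "nat \<Rightarrow> 'g set"
  assumes "disjoint_family (\<lambda>j. (\<lambda>x. - \<sigma> j + x) ` K j)"
  shows "disjoint_family (\<lambda>j. (\<lambda>x. u + - \<sigma> j + x) ` K j)"
  unfolding disjoint_family_on_def
proof (intro ballI impI)
  fix i j :: nat assume "i \<noteq> j"
  then have "(\<lambda>x. - \<sigma> i + x) ` K i \<inter> (\<lambda>x. - \<sigma> j + x) ` K j = {}"
    using assms by (auto simp: disjoint_family_on_def)
  then have "(\<lambda>x. u + x) ` ((\<lambda>x. - \<sigma> i + x) ` K i) \<inter> (\<lambda>x. u + x) ` ((\<lambda>x. - \<sigma> j + x) ` K j) = {}"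
    by (subst image_Int[symmetric]) (auto simp: inj_on_def)
  then show "(\<lambda>x. u + - \<sigma> i + x) ` K i \<inter> (\<lambda>x. u + - \<sigma> j + x) ` K j = {}"
    by (simp only: image_image add.assoc)
qed

text \<open>The summand \<open>0\<close> is kept because this bound is used as the row of the identity in the double sum.\<close>

lemma Lp_modular_glue:
  fixes h :: "nat \<Rightarrow> 'g \<Rightarrow> complex"
  assumes K: "\<And>j. compact (K j)" and h: "\<And>j t. norm (h j t) \<le> c j * indicator (K j) t"
    and disj: "disjoint_family (\<lambda>j. (\<lambda>x. - \<sigma> j + x) ` K j)"
  shows "Lp_modular \<nu> p (glue \<sigma> h)
      \<le> (\<Sum>j. ennreal (c j powr p) * emeasure \<nu> ((\<lambda>x. 0 + - \<sigma> j + x) ` K j))"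
  unfolding glue_def
proof (rule Lp_modular_disjoint_sum_le[OF _ disjoint_family_translate[OF disj] _ p_pos])
  show "(\<lambda>x. 0 + - \<sigma> j + x) ` K j \<in> sets \<nu>" for j
    unfolding sets_\<nu> by (intro compact_in_M compact_translation_image K)
  show "norm (h j (\<sigma> j + t)) \<le> c j * indicator ((\<lambda>x. 0 + - \<sigma> j + x) ` K j) t" for j t
    using translate_support[of "h j" "c j" "K j" "\<sigma> j" 0 t, OF h] by simp
qed

text \<open>
  The translate of \<open>glue \<sigma> h\<close> by \<open>\<sigma> i\<close> is the sum of the functions \<open>h j\<close> moved to the disjoint sets
  \<open>\<sigma> i - \<sigma> j + K j\<close>. The term \<open>j = i\<close> is \<open>h i\<close> itself, and the others add up to a weighted row of the
  double sum.
\<close>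

lemma Lp_modular_translate_glue_diff:
  fixes h :: "nat \<Rightarrow> 'g \<Rightarrow> complex"
  assumes K: "\<And>j. compact (K j)" and h: "\<And>j t. norm (h j t) \<le> c j * indicator (K j) t"
    and disj: "disjoint_family (\<lambda>j. (\<lambda>x. - \<sigma> j + x) ` K j)"
  shows "Lp_modular \<nu> p (\<lambda>t. translate (\<sigma> i) (glue \<sigma> h) t - h i t)
      \<le> (\<Sum>j. ennreal (c j powr p) * (if i = j then 0 else emeasure \<nu> ((\<lambda>x. \<sigma> i + - \<sigma> j + x) ` K j)))"
proof -
  define E where "E j = (\<lambda>x. \<sigma> i + - \<sigma> j + x) ` K j" for j
  have E_disj: "disjoint_family E" unfolding E_def by (rule disjoint_family_translate[OF disj])
  have E_M: "E j \<in> sets M" for j unfolding E_def by (intro compact_in_M compact_translation_image K)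
  have hE: "norm (h j (\<sigma> j + (- \<sigma> i + t))) \<le> c j * indicator (E j) t" for j t
    unfolding E_def by (rule translate_support[OF h])
  have eq: "translate (\<sigma> i) (glue \<sigma> h) t - h i t = (\<Sum>j. if j = i then 0 else h j (\<sigma> j + (- \<sigma> i + t)))" for t
  proof -
    have "j = k" if "h j (\<sigma> j + (- \<sigma> i + t)) \<noteq> 0" "h k (\<sigma> k + (- \<sigma> i + t)) \<noteq> 0" for j k
    proof (rule ccontr)
      assume "j \<noteq> k"
      have "t \<in> E j" using hE[of j t] that(1) by (cases "t \<in> E j") auto
      moreover have "t \<in> E k" using hE[of k t] that(2) by (cases "t \<in> E k") auto
      ultimately show False using disjoint_family_onD[OF E_disj, of j k] \<open>j \<noteq> k\<close> by auto
    qed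
    from suminf_single_support[of "\<lambda>j. h j (\<sigma> j + (- \<sigma> i + t))" i, OF this]
    show ?thesis by (simp add: translate_def glue_def add.assoc[symmetric])
  qed
  have "Lp_modular \<nu> p (\<lambda>t. \<Sum>j. if j = i then 0 else h j (\<sigma> j + (- \<sigma> i + t)))
      \<le> (\<Sum>j. ennreal (c j powr p) * emeasure \<nu> (if j = i then {} else E j))"
  proof (rule Lp_modular_disjoint_sum_le[OF _ _ _ p_pos])
    show "(if j = i then {} else E j) \<in> sets \<nu>" for j using E_M by (simp add: sets_\<nu>)
    show "disjoint_family (\<lambda>j. if j = i then {} else E j)"
      using E_disj by (auto simp: disjoint_family_on_def)
    show "norm (if j = i then 0 else h j (\<sigma> j + (- \<sigma> i + t)))
        \<le> c j * indicator (if j = i then {} else E j) t" for j t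
      using hE[of j t] by simp
  qed
  also have "\<dots> = (\<Sum>j. ennreal (c j powr p) * (if i = j then 0 else emeasure \<nu> (E j)))"
    by (intro suminf_cong) simp
  finally show ?thesis unfolding eq E_def .
qed

lemma sufficiency:
  assumes adm: "admissible M p S \<omega>"
    and cond: "\<And>F \<delta>. (\<forall>n\<ge>1. compact (F n) \<and> F n \<subseteq> F (n + 1) \<and> 0 < \<delta> n) \<Longrightarrow> disperses S F \<delta>"
  shows "\<exists>f. dense_vector M p S \<omega> f"
proof -
  obtain D where D: "countable D" "D \<noteq> {}"
    "\<And>d. d \<in> D \<Longrightarrow> d \<in> borel_measurable borel"
    "\<And>d. d \<in> D \<Longrightarrow> \<exists>C B. compact C \<and> 0 \<le> B \<and> (\<forall>t. norm (d t) \<le> B * indicator C t)"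
    "\<And>g \<epsilon>. g \<in> Lp_space M p \<omega> \<Longrightarrow> 0 < \<epsilon> \<Longrightarrow> \<exists>d\<in>D. Lp_modular \<nu> p (\<lambda>t. g t - d t) < ennreal \<epsilon>"
    by (rule countable_dense_compact_support) blast
  define e where "e = from_nat_into D"
  have e: "range e = D" unfolding e_def by (rule range_from_nat_into[OF D(2,1)])
  define g where "g j = e (fst (prod_decode j))" for j
  have gD: "g j \<in> D" for j using e by (auto simp: g_def)
  (* Repetitions are needed because the approximation is good only for late indices. *)
  have g_often: "\<exists>j\<ge>N. g j = d" if "d \<in> D" for d N
  proof -
    obtain m where "d = e m" using \<open>d \<in> D\<close> e by blast
    then have "g (prod_encode (m, N)) = d" by (simp add: g_def)
    then show ?thesis using le_prod_encode_2 by blast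
  qed
  have "\<exists>C c. compact C \<and> 0 < c \<and> (\<forall>t. norm (g j t) \<le> c * indicator C t)" for j
  proof -
    obtain C B where CB: "compact C" "0 \<le> B" "\<And>t. norm (g j t) \<le> B * indicator C t"
      using D(4)[OF gD] by blast
    have "norm (g j t) \<le> (B + 1) * indicator C t" for t
      using CB(3)[of t] by (cases "t \<in> C") auto
    then show ?thesis using CB(1,2) by (intro exI[of _ C] exI[of _ "B + 1"]) auto
  qed
  then obtain C c where C: "\<And>j. compact (C j)" and c: "\<And>j. 0 < c j"
    and gC: "\<And>j t. norm (g j t) \<le> c j * indicator (C j) t"
    by metis
  define F where "F n = (\<Union>j\<le>n. C j)" for n
  have F: "compact (F n)" for n unfolding F_def using C by (intro compact_UN) auto
  have F_mono: "F m \<subseteq> F n" if "m \<le> n" for m n unfolding F_def using that by (intro UN_mono) auto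
  have "\<exists>\<delta>>0. \<forall>A. A \<in> sets M \<longrightarrow> A \<subseteq> F n \<longrightarrow> emeasure M A < ennreal \<delta> \<longrightarrow> emeasure \<nu> A < ennreal ((1/2) ^ n)" for n
  proof (rule absolutely_continuous_epsilon_delta[OF ac_M_\<nu> sets_\<nu> compact_in_M[OF F[of n]] emeasure_\<nu>_compact[OF F[of n]]])
    show "0 < (1/2 :: real) ^ n" by simp
  qed blast
  then obtain \<delta> where \<delta>: "\<And>n. 0 < \<delta> n"
    "\<And>n A. A \<in> sets M \<Longrightarrow> A \<subseteq> F n \<Longrightarrow> emeasure M A < ennreal (\<delta> n) \<Longrightarrow> emeasure \<nu> A < ennreal ((1/2) ^ n)"
    by metis
  have "\<forall>n\<ge>1. compact (F n) \<and> F n \<subseteq> F (n + 1) \<and> 0 < \<delta> n" using F \<delta>(1) F_mono by simp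
  from cond[OF this, unfolded disperses_def] obtain s K where s0: "s 0 = 0" "K 0 = {}"
    and sK: "\<And>n. 1 \<le> n \<Longrightarrow> s n \<in> S" "\<And>n. 1 \<le> n \<Longrightarrow> compact (K n)" "\<And>n. 1 \<le> n \<Longrightarrow> K n \<subseteq> F n"
      "\<And>n. 1 \<le> n \<Longrightarrow> emeasure \<mu> (F n - K n) < ennreal (\<delta> n)"
    and disj: "disjoint_family_on (\<lambda>n. (\<lambda>x. - s n + x) ` F n) {1..}"
    and total: "(\<Sum>\<^sub>\<infinity>(n, k)\<in>{(n, k). n \<noteq> k}.
             \<integral>\<^sup>+t\<in>(\<lambda>x. s n + - s k + x) ` K k. ennreal (\<omega> t powr p) \<partial>completion \<mu>) < \<infinity>"
    by blast
  have compK: "compact (K n)" for n using sK(2)[of n] s0(2) by (cases "n = 0") auto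
  define a where "a n k = emeasure \<nu> ((\<lambda>x. s n + - s k + x) ` K k)" for n k
  define A where "A k = (\<Sum>n. if n = k then 0 else a n k)" for k
  have a_int: "(\<integral>\<^sup>+t\<in>(\<lambda>x. s n + - s k + x) ` K k. ennreal (\<omega> t powr p) \<partial>completion \<mu>) = a n k" for n k
    unfolding a_def by (rule emeasure_\<nu>[OF compact_in_M[OF compact_translation_image[OF compK]], symmetric])
  have A_sum: "(\<Sum>k. A k) < \<infinity>"
    using suminf_columns_le_infsum[of a] total unfolding a_int A_def by (rule le_less_trans)
  have a_le_A: "a n k \<le> A k" if "n \<noteq> k" for n k
    using sum_le_suminf[of "\<lambda>n. if n = k then 0 else a n k" "{n}"] that by (simp add: A_def)
  have half: "(\<Sum>k. ennreal ((1/2) ^ k)) = ennreal 2"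
    using suminf_geometric[of "1/2 :: real"] by (subst suminf_ennreal2) auto
  have A'_sum: "(\<Sum>k. A k + ennreal ((1/2) ^ k)) < \<infinity>"
    using A_sum by (subst suminf_add[symmetric]) (auto simp: half)
  (* An index n serves for g j when both its column sum and the truncation error allowed at n
     remain below (1/2)^j after multiplication by the bound c j powr p. *)
  define r where "r j = (1/2) ^ j / c j powr p" for j
  have r: "0 < r j" for j using c[of j] by (simp add: r_def)
  have "\<exists>n\<ge>N. A n + ennreal ((1/2) ^ n) < ennreal (r j)" for j N
  proof (rule suminf_finite_tail_small[OF A'_sum r[of j]])
    fix N' assume "\<And>n. N' \<le> n \<Longrightarrow> A n + ennreal ((1/2) ^ n) < ennreal (r j)"
    from this[of "max N N'"] show ?thesis by (intro exI[of _ "max N N'"]) auto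
  qed
  then obtain \<tau> where \<tau>: "strict_mono \<tau>" "\<And>j. A (\<tau> j) + ennreal ((1/2) ^ \<tau> j) < ennreal (r j)" "\<And>j. j < \<tau> j"
    by (rule strict_mono_choice[where P = "\<lambda>j n. A n + ennreal ((1/2) ^ n) < ennreal (r j)"]) blast
  have \<tau>_ge1: "1 \<le> \<tau> j" and \<tau>_neq0: "\<tau> j \<noteq> 0" for j using \<tau>(3)[of j] by auto
  have \<tau>_eq: "\<tau> i = \<tau> j \<longleftrightarrow> i = j" for i j using \<tau>(1) by (simp add: strict_mono_eq)
  have scaled: "ennreal (c j powr p) * x \<le> ennreal ((1/2) ^ j)" if x: "x \<le> A (\<tau> j) + ennreal ((1/2) ^ \<tau> j)" for j x
  proof -
    have "x \<le> ennreal (r j)" using x \<tau>(2)[of j] by (meson less_imp_le order_trans)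
    then have "ennreal (c j powr p) * x \<le> ennreal (c j powr p) * ennreal (r j)" by (rule mult_left_mono) simp
    also have "\<dots> = ennreal (c j powr p * r j)" using r[of j] by (intro ennreal_mult[symmetric]) auto
    also have "c j powr p * r j = (1/2) ^ j" using c[of j] by (simp add: r_def)
    finally show ?thesis .
  qed
  define \<sigma> where "\<sigma> j = s (\<tau> j)" for j
  define K' where "K' j = K (\<tau> j)" for j
  define h where "h j t = g j t * indicator (K' j) t" for j t
  define f where "f = glue \<sigma> h"
  have K': "compact (K' j)" for j unfolding K'_def by (rule compK)
  have h_bound: "norm (h j t) \<le> c j * indicator (K' j) t" for j t
    using gC[of j t] c[of j] by (cases "t \<in> C j") (auto simp: h_def indicator_def)
  have h_borel: "h j \<in> borel_measurable borel" for j
    unfolding h_def using D(3)[OF gD[of j]] borel_compact[OF K'[of j]] by measurable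
  have disj': "disjoint_family (\<lambda>j. (\<lambda>x. - \<sigma> j + x) ` K' j)"
    unfolding disjoint_family_on_def
  proof (intro ballI impI)
    fix i j :: nat assume "i \<noteq> j"
    then have "(\<lambda>x. - \<sigma> i + x) ` F (\<tau> i) \<inter> (\<lambda>x. - \<sigma> j + x) ` F (\<tau> j) = {}"
      unfolding \<sigma>_def using \<tau>_ge1 \<tau>_eq by (intro disjoint_family_onD[OF disj]) auto
    moreover have "K' i \<subseteq> F (\<tau> i)" "K' j \<subseteq> F (\<tau> j)" unfolding K'_def by (rule sK(3)[OF \<tau>_ge1])+
    ultimately show "(\<lambda>x. - \<sigma> i + x) ` K' i \<inter> (\<lambda>x. - \<sigma> j + x) ` K' j = {}" by blast
  qed
  have f_borel: "f \<in> borel_measurable borel" unfolding f_def by (rule glue_measurable[OF h_borel])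
  have "Lp_modular \<nu> p f \<le> (\<Sum>j. ennreal (c j powr p) * emeasure \<nu> ((\<lambda>x. 0 + - \<sigma> j + x) ` K' j))"
    unfolding f_def by (rule Lp_modular_glue[OF K' h_bound disj'])
  also have "\<dots> \<le> (\<Sum>j. ennreal ((1/2) ^ j))"
  proof (intro suminf_le summableI scaled)
    fix j
    have "emeasure \<nu> ((\<lambda>x. 0 + - \<sigma> j + x) ` K' j) = a 0 (\<tau> j)"
      by (simp only: a_def s0(1) \<sigma>_def K'_def)
    also have "\<dots> \<le> A (\<tau> j)" using \<tau>_neq0[of j] by (intro a_le_A) simp
    finally show "emeasure \<nu> ((\<lambda>x. 0 + - \<sigma> j + x) ` K' j) \<le> A (\<tau> j) + ennreal ((1/2) ^ \<tau> j)"
      by (rule order_trans) simp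
  qed
  also have "\<dots> < \<infinity>" by (simp add: half)
  finally have f_Lp: "f \<in> Lp_space M p \<omega>"
    unfolding Lp_space_iff using borel_measurable_M[OF f_borel] by simp
  have translate_Lp: "translate s f \<in> Lp_space M p \<omega>" if "s \<in> S" for s
    using adm that f_Lp unfolding admissible_def by blast
  define R where "R i = (\<Sum>j. ennreal (c j powr p) * (if i = j then 0 else emeasure \<nu> ((\<lambda>x. \<sigma> i + - \<sigma> j + x) ` K' j)))" for i
  have R: "Lp_modular \<nu> p (\<lambda>t. translate (\<sigma> i) f t - h i t) \<le> R i" for i
    unfolding f_def R_def by (rule Lp_modular_translate_glue_diff[OF K' h_bound disj'])
  have "(\<Sum>i. R i) = (\<Sum>i. \<Sum>j. ennreal (c j powr p) * (if \<tau> i = \<tau> j then 0 else a (\<tau> i) (\<tau> j)))"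
    unfolding R_def by (simp only: \<tau>_eq a_def \<sigma>_def K'_def)
  also have "\<dots> = (\<Sum>j. \<Sum>i. ennreal (c j powr p) * (if \<tau> i = \<tau> j then 0 else a (\<tau> i) (\<tau> j)))"
    by (rule ennreal_suminf_commute)
  also have "\<dots> = (\<Sum>j. ennreal (c j powr p) * (\<Sum>i. if \<tau> i = \<tau> j then 0 else a (\<tau> i) (\<tau> j)))"
    by simp
  also have "\<dots> \<le> (\<Sum>j. ennreal ((1/2) ^ j))"
  proof (intro suminf_le summableI scaled)
    fix j
    have "inj \<tau>" using \<tau>(1) by (rule strict_mono_imp_inj_on)
    then have "(\<Sum>i. if \<tau> i = \<tau> j then 0 else a (\<tau> i) (\<tau> j)) \<le> A (\<tau> j)"
      unfolding A_def by (rule suminf_subsequence_le)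
    then show "(\<Sum>i. if \<tau> i = \<tau> j then 0 else a (\<tau> i) (\<tau> j)) \<le> A (\<tau> j) + ennreal ((1/2) ^ \<tau> j)"
      by (rule order_trans) simp
  qed
  also have "\<dots> < \<infinity>" by (simp add: half)
  finally have R_sum: "(\<Sum>i. R i) < \<infinity>" .
  have truncation: "Lp_modular \<nu> p (\<lambda>t. h i t - g i t) \<le> ennreal ((1/2) ^ i)" for i
  proof -
    have FK: "F (\<tau> i) - K' i \<in> sets M" using F K' by (intro sets.Diff compact_in_M)
    have "C i \<subseteq> F (\<tau> i)" unfolding F_def using \<tau>(3)[of i] by (intro UN_upper) simp
    then have "norm (h i t - g i t) \<le> norm (of_real (c i) * indicator (F (\<tau> i) - K' i) t :: complex)" for t
      using gC[of i t] c[of i] by (cases "t \<in> K' i"; cases "t \<in> C i") (auto simp: h_def norm_mult)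
    then have "Lp_modular \<nu> p (\<lambda>t. h i t - g i t) \<le> Lp_modular \<nu> p (\<lambda>t. of_real (c i) * indicator (F (\<tau> i) - K' i) t)"
      using p_nonneg by (rule Lp_modular_mono)
    also have "\<dots> = ennreal (c i powr p) * emeasure \<nu> (F (\<tau> i) - K' i)"
      using FK p_pos c[of i] by (subst Lp_modular_mult_indicator) (auto simp: sets_\<nu>)
    also have "\<dots> \<le> ennreal ((1/2) ^ i)"
    proof (rule scaled)
      have "emeasure M (F (\<tau> i) - K' i) < ennreal (\<delta> (\<tau> i))"
        using sK(4)[OF \<tau>_ge1[of i]] F K' unfolding K'_def
        by (subst emeasure_M_borel) (auto intro: borel_compact)
      then have "emeasure \<nu> (F (\<tau> i) - K' i) < ennreal ((1/2) ^ \<tau> i)"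
        by (intro \<delta>(2) FK) auto
      then have "emeasure \<nu> (F (\<tau> i) - K' i) \<le> ennreal ((1/2) ^ \<tau> i)" by (rule less_imp_le)
      then show "emeasure \<nu> (F (\<tau> i) - K' i) \<le> A (\<tau> i) + ennreal ((1/2) ^ \<tau> i)"
        by (rule order_trans) simp
    qed
    finally show ?thesis .
  qed
  have "dense_vector M p S \<omega> f"
    unfolding dense_vector_def
  proof (intro conjI ballI allI impI f_Lp translate_Lp)
    fix u and \<epsilon> :: real assume u: "u \<in> Lp_space M p \<omega>" and "0 < \<epsilon>"
    (* translate f - u = (translate f - h i) + ((h i - d) + (d - u)): two uses of the quasi-triangle
       inequality, hence two tolerances. *)
    define \<eta>1 where "\<eta>1 = \<epsilon> powr p / (2 * 2 powr p)"
    define \<eta>2 where "\<eta>2 = \<eta>1 / (2 * 2 powr p)"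
    have \<eta>: "0 < \<eta>1" "0 < \<eta>2" "\<eta>2 \<le> \<eta>1"
    proof -
      show "0 < \<eta>1" using \<open>0 < \<epsilon>\<close> by (simp add: \<eta>1_def)
      then show "0 < \<eta>2" by (simp add: \<eta>2_def)
      have "1 \<le> 2 * 2 powr p" using ge_one_powr_ge_zero[of 2 p] p_nonneg by simp
      then show "\<eta>2 \<le> \<eta>1" using \<open>0 < \<eta>1\<close> by (simp add: \<eta>2_def divide_le_eq mult_le_cancel_left1)
    qed
    obtain d where d: "d \<in> D" "Lp_modular \<nu> p (\<lambda>t. u t - d t) < ennreal \<eta>2" using D(5)[OF u \<eta>(2)] by blast
    obtain N1 where N1: "\<And>i. N1 \<le> i \<Longrightarrow> R i < ennreal \<eta>1" using suminf_finite_tail_small[OF R_sum \<eta>(1)] by blast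
    obtain N2 where N2: "(1/2 :: real) ^ N2 < \<eta>2" using real_arch_pow_inv[OF \<eta>(2), of "1/2"] by auto
    obtain i where i: "max N1 N2 \<le> i" "g i = d" using g_often[OF d(1)] by blast
    have u_meas: "u \<in> borel_measurable \<nu>" using u by (simp add: Lp_space_iff measurable_\<nu>)
    have d_meas: "d \<in> borel_measurable \<nu>" using borel_measurable_M[OF D(3)[OF d(1)]] by (simp add: measurable_\<nu>)
    have h_meas: "h i \<in> borel_measurable \<nu>" using borel_measurable_M[OF h_borel] by (simp add: measurable_\<nu>)
    have \<sigma>S: "\<sigma> i \<in> S" unfolding \<sigma>_def by (rule sK(1)[OF \<tau>_ge1])
    have T_meas: "translate (\<sigma> i) f \<in> borel_measurable \<nu>"
      using translate_Lp[OF \<sigma>S] by (simp add: Lp_space_iff measurable_\<nu>)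
    have near_u: "Lp_modular \<nu> p (\<lambda>t. (h i t - d t) + (d t - u t)) < ennreal \<eta>1"
    proof (rule Lp_modular_add_less)
      have "(1/2 :: real) ^ i \<le> (1/2) ^ N2" using i(1) by (intro power_decreasing) auto
      then have "ennreal ((1/2) ^ i) < ennreal \<eta>2" using N2 by (intro ennreal_lessI \<eta>(2)) (rule le_less_trans)
      then show "Lp_modular \<nu> p (\<lambda>t. h i t - d t) < ennreal (\<eta>1 / (2 * 2 powr p))"
        using truncation[of i] unfolding i(2) \<eta>2_def[symmetric] by (rule le_less_trans[rotated])
      show "Lp_modular \<nu> p (\<lambda>t. d t - u t) < ennreal (\<eta>1 / (2 * 2 powr p))"
        using d(2) unfolding Lp_modular_def \<eta>2_def by (simp only: norm_minus_commute)
      show "(\<lambda>t. h i t - d t) \<in> borel_measurable \<nu>"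
        by (rule borel_measurable_diff[OF h_meas d_meas])
      show "(\<lambda>t. d t - u t) \<in> borel_measurable \<nu>"
        by (rule borel_measurable_diff[OF d_meas u_meas])
    qed (rule p_nonneg)
    have near_h: "Lp_modular \<nu> p (\<lambda>t. translate (\<sigma> i) f t - h i t) < ennreal \<eta>1"
      using i(1) by (intro le_less_trans[OF R N1]) simp
    have "Lp_modular \<nu> p (\<lambda>t. (translate (\<sigma> i) f t - h i t) + ((h i t - d t) + (d t - u t))) < ennreal (\<epsilon> powr p)"
    proof (rule Lp_modular_add_less[OF _ _ p_nonneg near_h[unfolded \<eta>1_def] near_u[unfolded \<eta>1_def]])
      show "(\<lambda>t. translate (\<sigma> i) f t - h i t) \<in> borel_measurable \<nu>"
        by (rule borel_measurable_diff[OF T_meas h_meas])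
      show "(\<lambda>t. (h i t - d t) + (d t - u t)) \<in> borel_measurable \<nu>"
        by (rule borel_measurable_add[OF borel_measurable_diff[OF h_meas d_meas] borel_measurable_diff[OF d_meas u_meas]])
    qed
    then have "Lp_modular \<nu> p (\<lambda>t. translate (\<sigma> i) f t - u t) < ennreal (\<epsilon> powr p)" by simp
    then have "Lp_norm M p \<omega> (\<lambda>t. translate (\<sigma> i) f t - u t) < \<epsilon>"
      by (rule Lp_norm_less_iff[OF Lp_space_diff[OF translate_Lp[OF \<sigma>S] u] \<open>0 < \<epsilon>\<close>, THEN iffD2])
    then show "\<exists>s\<in>S. Lp_norm M p \<omega> (\<lambda>t. translate s f t - u t) < \<epsilon>" using \<sigma>S by blast
  qed
  then show ?thesis by blast
qed

end

theorem theorem5: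
  fixes \<mu> :: "'g :: {topological_group_add, t2_space, second_countable_topology} measure"
    and p :: real and S :: "'g set" and \<omega> :: "'g \<Rightarrow> real"
  assumes "locally compact (UNIV :: 'g set)"
    and "\<not> compact (UNIV :: 'g set)"
    and "left_haar_measure \<mu>"
    and "1 \<le> p"
    and "weight (completion \<mu>) p \<omega>"
    and "admissible (completion \<mu>) p S \<omega>"
  shows "(\<exists>f. dense_vector (completion \<mu>) p S \<omega> f) \<longleftrightarrow>
    (\<forall>(F :: nat \<Rightarrow> 'g set) (\<delta> :: nat \<Rightarrow> real).
       (\<forall>n\<ge>1. compact (F n) \<and> F n \<subseteq> F (n + 1) \<and> 0 < \<delta> n) \<longrightarrow>
       (\<exists>(s :: nat \<Rightarrow> 'g) (K :: nat \<Rightarrow> 'g set).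
          s 0 = 0 \<and> K 0 = {} \<and>
          (\<forall>n\<ge>1. s n \<in> S \<and> compact (K n) \<and> K n \<subseteq> F n \<and>
                  emeasure \<mu> (F n - K n) < ennreal (\<delta> n)) \<and>
          disjoint_family_on (\<lambda>n. (\<lambda>x. - s n + x) ` F n) {1..} \<and>
          (\<Sum>\<^sub>\<infinity>(n, k)\<in>{(n, k). n \<noteq> k}.
             \<integral>\<^sup>+t\<in>(\<lambda>x. s n + - s k + x) ` K k. ennreal (\<omega> t powr p) \<partial>completion \<mu>) < \<infinity>))"
proof -
  interpret weighted_haar \<mu> p \<omega>
    using assms by unfold_locales
  have "(\<exists>f. dense_vector (completion \<mu>) p S \<omega> f) \<longleftrightarrow>
    (\<forall>F \<delta>. (\<forall>n\<ge>1. compact (F n) \<and> F n \<subseteq> F (n + 1) \<and> 0 < \<delta> n) \<longrightarrow> disperses S F \<delta>)"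
    (is "_ \<longleftrightarrow> (\<forall>F \<delta>. ?chain F \<delta> \<longrightarrow> _)")
  proof (intro iffI allI impI)
    fix F \<delta>
    assume "\<exists>f. dense_vector (completion \<mu>) p S \<omega> f" and F: "?chain F \<delta>"
    then obtain f where "dense_vector (completion \<mu>) p S \<omega> f" by blast
    then show "disperses S F \<delta>" by (rule necessity) (use F in blast)+
  next
    assume *: "\<forall>F \<delta>. ?chain F \<delta> \<longrightarrow> disperses S F \<delta>"
    show "\<exists>f. dense_vector (completion \<mu>) p S \<omega> f"
      by (rule sufficiency[OF assms(6)]) (rule *[THEN spec, THEN spec, THEN mp])
  qed
  then show ?thesis unfolding disperses_def .
qed

end
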